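(* There is a model of $\mathsf Z_2^\omega$ in which $\neg\mathsf{PIT}_o$ holds.
   Context: $\mathsf{RCA}_0^\omega$ is Kohlenbach's base theory of higher-order arithmetic in all finite types (basic arithmetic, combinators, primitive recursion, extensionality, quantifier-free induction, $\mathsf{QF\text{-}AC}^{1,0}$). $S^2_k$ is the type $2$ functional deciding the truth of $\Sigma^1_k$-formulas (with function parameters only, not functionals); $\Pi^1_k\text{-}\mathsf{CA}_0^\omega=\mathsf{RCA}_0^\omega+(\exists S^2_k)$ and $\mathsf Z_2^\omega=\bigcup_k\Pi^1_k\text{-}\mathsf{CA}_0^\omega$. $C=2^{\mathbb N}$, $\overline{f}n=\langle f(0),\dots,f(n-1)\rangle$, $[\sigma]$ = binary extensions of $\sigma$. $\mathsf{LOC}(F,G)\equiv(\forall f,g\in C)(g\in[\overline{f}G(f)]\to F(g)\le G(f))$. $\mathsf{PIT}_o$: $(\forall F,G:C\to\mathbb N)(\exists N\in\mathbb N)[\mathsf{LOC}(F,G)\to(\forall g\in C)(F(g)\le N)]$. *)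

theory Defs
  imports Main
begin

datatype ftype = TZ | TFn ftype ftype

abbreviation T1 :: ftype where "T1 \<equiv> TFn TZ TZ"
abbreviation T2 :: ftype where "T2 \<equiv> TFn T1 TZ"

text \<open>Constants: 0, successor, combinators Pi (K) and Sigma (S) for all types,
  and the recursor R_0 (Kleene primitive recursion, type-0 values):
  R 0 y z = y,  R (S x) y z = z (R x y z) x.\<close>
datatype const = CZero | CSuc | CK ftype ftype | CS ftype ftype ftype | CR

fun ctype :: "const \<Rightarrow> ftype" where
  "ctype CZero = TZ"
| "ctype CSuc = TFn TZ TZ"
| "ctype (CK r s) = TFn r (TFn s r)"
| "ctype (CS r s t) = TFn (TFn r (TFn s t)) (TFn (TFn r s) (TFn r t))"
| "ctype CR = TFn TZ (TFn TZ (TFn (TFn TZ (TFn TZ TZ)) TZ))"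

datatype trm = TVar nat ftype | TCst const | TApp trm trm

fun ty :: "trm \<Rightarrow> ftype option" where
  "ty (TVar n s) = Some s"
| "ty (TCst c) = Some (ctype c)"
| "ty (TApp s t) = (case (ty s, ty t) of
      (Some (TFn a b), Some a') \<Rightarrow> (if a = a' then Some b else None)
    | _ \<Rightarrow> None)"

text \<open>Formulas: only type-0 equality is primitive (higher type equality is defined
  extensionally); negation is implication to falsum.\<close>
datatype fm = FEq trm trm | FBot | FConj fm fm | FDisj fm fm | FImp fm fm
  | FAll nat ftype fm | FEx nat ftype fm

definition FNeg :: "fm \<Rightarrow> fm" where "FNeg A = FImp A FBot"
definition FIff :: "fm \<Rightarrow> fm \<Rightarrow> fm" where "FIff A B = FConj (FImp A B) (FImp B A)"

fun wf_fm :: "fm \<Rightarrow> bool" where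
  "wf_fm (FEq s t) = (ty s = Some TZ \<and> ty t = Some TZ)"
| "wf_fm FBot = True"
| "wf_fm (FConj A B) = (wf_fm A \<and> wf_fm B)"
| "wf_fm (FDisj A B) = (wf_fm A \<and> wf_fm B)"
| "wf_fm (FImp A B) = (wf_fm A \<and> wf_fm B)"
| "wf_fm (FAll n s A) = wf_fm A"
| "wf_fm (FEx n s A) = wf_fm A"

fun qf :: "fm \<Rightarrow> bool" where
  "qf (FEq s t) = True"
| "qf FBot = True"
| "qf (FConj A B) = (qf A \<and> qf B)"
| "qf (FDisj A B) = (qf A \<and> qf B)"
| "qf (FImp A B) = (qf A \<and> qf B)"
| "qf (FAll n s A) = False"
| "qf (FEx n s A) = False"

datatype lam = LV nat ftype | LC const | LA lam lam | LL nat ftype lam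

definition Icomb :: "ftype \<Rightarrow> trm" where
  "Icomb s = TApp (TApp (TCst (CS s (TFn s s) s)) (TCst (CK s (TFn s s)))) (TCst (CK s s))"

fun absn :: "nat \<Rightarrow> ftype \<Rightarrow> trm \<Rightarrow> trm" where
  "absn n s (TVar m t) = (if m = n \<and> t = s then Icomb s else TApp (TCst (CK t s)) (TVar m t))"
| "absn n s (TCst c) = TApp (TCst (CK (ctype c) s)) (TCst c)"
| "absn n s (TApp u v) = (case ty u of
      Some (TFn b g) \<Rightarrow> TApp (TApp (TCst (CS s b g)) (absn n s u)) (absn n s v)
    | _ \<Rightarrow> TCst CZero)"

fun comp :: "lam \<Rightarrow> trm" where
  "comp (LV n s) = TVar n s"
| "comp (LC c) = TCst c"
| "comp (LA u v) = TApp (comp u) (comp v)"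
| "comp (LL n s u) = absn n s (comp u)"

abbreviation LZ :: ftype where "LZ \<equiv> TZ"

definition lR :: "lam \<Rightarrow> lam \<Rightarrow> lam \<Rightarrow> lam" where
  "lR x y z = LA (LA (LA (LC CR) x) y) z"

definition lApp2 :: "lam \<Rightarrow> lam \<Rightarrow> lam \<Rightarrow> lam" where
  "lApp2 f x y = LA (LA f x) y"

definition predL :: lam where
  "predL = LL 1 TZ (lR (LV 1 TZ) (LC CZero) (LL 2 TZ (LL 3 TZ (LV 3 TZ))))"

definition monusL :: lam where
  "monusL = LL 1 TZ (LL 2 TZ (lR (LV 2 TZ) (LV 1 TZ) (LL 3 TZ (LL 4 TZ (LA predL (LV 3 TZ))))))"

definition addL :: lam where
  "addL = LL 1 TZ (LL 2 TZ (lR (LV 2 TZ) (LV 1 TZ) (LL 3 TZ (LL 4 TZ (LA (LC CSuc) (LV 3 TZ))))))"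

definition mulL :: lam where
  "mulL = LL 1 TZ (LL 2 TZ (lR (LV 2 TZ) (LC CZero) (LL 3 TZ (LL 4 TZ (lApp2 addL (LV 3 TZ) (LV 1 TZ))))))"

text \<open>Injective pairing (x+y)*(x+y)+x, sequence codes of initial segments
  (code of empty = 0, code of s*a = pair(code s, a)+1), and tuples.\<close>
definition pairL :: "lam \<Rightarrow> lam \<Rightarrow> lam" where
  "pairL a b = (let s = lApp2 addL a b in lApp2 addL (lApp2 mulL s s) a)"

definition barL :: "lam \<Rightarrow> lam \<Rightarrow> lam" where
  "barL g n = lR n (LC CZero)
      (LL 1001 TZ (LL 1002 TZ (LA (LC CSuc) (pairL (LV 1001 TZ) (LA g (LV 1002 TZ))))))"

fun tupL :: "lam list \<Rightarrow> lam" where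
  "tupL [] = LC CZero"
| "tupL [a] = a"
| "tupL (a # as) = pairL a (tupL as)"

definition one :: trm where "one = TApp (TCst CSuc) (TCst CZero)"

definition leF :: "trm \<Rightarrow> trm \<Rightarrow> fm" where
  "leF a b = FEq (TApp (TApp (comp monusL) a) b) (TCst CZero)"

definition ltF :: "trm \<Rightarrow> trm \<Rightarrow> fm" where
  "ltF a b = leF (TApp (TCst CSuc) a) b"

record 'u str =
  dom :: "ftype \<Rightarrow> 'u set"
  ap  :: "'u \<Rightarrow> 'u \<Rightarrow> 'u"
  cst :: "const \<Rightarrow> 'u"

definition is_str :: "'u str \<Rightarrow> bool" where
  "is_str M \<longleftrightarrow> (\<forall>s. dom M s \<noteq> {})
     \<and> (\<forall>s t f x. f \<in> dom M (TFn s t) \<longrightarrow> x \<in> dom M s \<longrightarrow> ap M f x \<in> dom M t)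
     \<and> (\<forall>c. cst M c \<in> dom M (ctype c))"

type_synonym 'u env = "nat \<Rightarrow> ftype \<Rightarrow> 'u"

definition adm :: "'u str \<Rightarrow> 'u env \<Rightarrow> bool" where
  "adm M e \<longleftrightarrow> (\<forall>n s. e n s \<in> dom M s)"

definition upd :: "'u env \<Rightarrow> nat \<Rightarrow> ftype \<Rightarrow> 'u \<Rightarrow> 'u env" where
  "upd e n s x = e(n := (e n)(s := x))"

fun eval :: "'u str \<Rightarrow> 'u env \<Rightarrow> trm \<Rightarrow> 'u" where
  "eval M e (TVar n s) = e n s"
| "eval M e (TCst c) = cst M c"
| "eval M e (TApp u v) = ap M (eval M e u) (eval M e v)"

fun sat :: "'u str \<Rightarrow> 'u env \<Rightarrow> fm \<Rightarrow> bool" where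
  "sat M e (FEq u v) = (eval M e u = eval M e v)"
| "sat M e FBot = False"
| "sat M e (FConj A B) = (sat M e A \<and> sat M e B)"
| "sat M e (FDisj A B) = (sat M e A \<or> sat M e B)"
| "sat M e (FImp A B) = (sat M e A \<longrightarrow> sat M e B)"
| "sat M e (FAll n s A) = (\<forall>x\<in>dom M s. sat M (upd e n s x) A)"
| "sat M e (FEx n s A) = (\<exists>x\<in>dom M s. sat M (upd e n s x) A)"

definition valid :: "'u str \<Rightarrow> fm \<Rightarrow> bool" where
  "valid M A \<longleftrightarrow> (\<forall>e. adm M e \<longrightarrow> sat M e A)"

fun exteq :: "'u str \<Rightarrow> ftype \<Rightarrow> 'u \<Rightarrow> 'u \<Rightarrow> bool" where
  "exteq M TZ x y = (x = y)"
| "exteq M (TFn s t) x y = (\<forall>z\<in>dom M s. exteq M t (ap M x z) (ap M y z))"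

definition rca0w :: "'u str \<Rightarrow> bool" where
  "rca0w M \<longleftrightarrow>
     \<comment> \<open>basic arithmetic: successor axioms\<close>
     (\<forall>x\<in>dom M TZ. ap M (cst M CSuc) x \<noteq> cst M CZero)
   \<and> (\<forall>x\<in>dom M TZ. \<forall>y\<in>dom M TZ. ap M (cst M CSuc) x = ap M (cst M CSuc) y \<longrightarrow> x = y)
     \<comment> \<open>combinators\<close>
   \<and> (\<forall>r s. \<forall>x\<in>dom M r. \<forall>y\<in>dom M s. exteq M r (ap M (ap M (cst M (CK r s)) x) y) x)
   \<and> (\<forall>r s t. \<forall>x\<in>dom M (TFn r (TFn s t)). \<forall>y\<in>dom M (TFn r s). \<forall>z\<in>dom M r.
        exteq M t (ap M (ap M (ap M (cst M (CS r s t)) x) y) z) (ap M (ap M x z) (ap M y z)))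
     \<comment> \<open>primitive recursion\<close>
   \<and> (\<forall>y\<in>dom M TZ. \<forall>z\<in>dom M (TFn TZ (TFn TZ TZ)).
        ap M (ap M (ap M (cst M CR) (cst M CZero)) y) z = y
      \<and> (\<forall>x\<in>dom M TZ. ap M (ap M (ap M (cst M CR) (ap M (cst M CSuc) x)) y) z
           = ap M (ap M z (ap M (ap M (ap M (cst M CR) x) y) z)) x))
     \<comment> \<open>extensionality\<close>
   \<and> (\<forall>r t. \<forall>z\<in>dom M (TFn r t). \<forall>x\<in>dom M r. \<forall>y\<in>dom M r.
        exteq M r x y \<longrightarrow> exteq M t (ap M z x) (ap M z y))
     \<comment> \<open>quantifier-free induction (universal closures of all instances)\<close>
   \<and> (\<forall>A n e. qf A \<and> wf_fm A \<and> adm M e \<longrightarrow>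
        sat M (upd e n TZ (cst M CZero)) A
        \<and> (\<forall>x\<in>dom M TZ. sat M (upd e n TZ x) A \<longrightarrow> sat M (upd e n TZ (ap M (cst M CSuc) x)) A)
        \<longrightarrow> (\<forall>x\<in>dom M TZ. sat M (upd e n TZ x) A))
     \<comment> \<open>QF-AC^{1,0}\<close>
   \<and> (\<forall>A a b e. qf A \<and> wf_fm A \<and> adm M e \<longrightarrow>
        (\<forall>f\<in>dom M T1. \<exists>x\<in>dom M TZ. sat M (upd (upd e a T1 f) b TZ x) A)
        \<longrightarrow> (\<exists>Y\<in>dom M T2. \<forall>f\<in>dom M T1. sat M (upd (upd e a T1 f) b TZ (ap M Y f)) A))"

text \<open>The Sigma^1_k normal form
  (exists g1)(forall g2)...(Q gk)(Q' n) f(<overline g1 n, ..., overline gk n>) = 0,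
  with f = variable (0,T1), g_j = variable (j,T1), n = variable (0,TZ).\<close>
definition sigma_fm :: "nat \<Rightarrow> fm" where
  "sigma_fm k =
    (let mat = FEq (TApp (TVar 0 T1)
                  (comp (tupL (map (\<lambda>j. barL (LV j T1) (LV 0 TZ)) [1..<k+1])))) (TCst CZero);
         body = (if odd k then FAll 0 TZ mat else FEx 0 TZ mat)
     in foldr (\<lambda>j A. if odd j then FEx j T1 A else FAll j T1 A) [1..<k+1] body)"

definition Sk_ax :: "nat \<Rightarrow> fm" where
  "Sk_ax k = FEx 0 T2 (FAll 0 T1 (FConj (leF (TApp (TVar 0 T2) (TVar 0 T1)) one)
        (FIff (FEq (TApp (TVar 0 T2) (TVar 0 T1)) (TCst CZero)) (sigma_fm k))))"

definition model_Z2w :: "'u str \<Rightarrow> bool" where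
  "model_Z2w M \<longleftrightarrow> is_str M \<and> rca0w M \<and> (\<forall>k\<ge>1. valid M (Sk_ax k))"

definition inC :: "trm \<Rightarrow> fm" where   \<comment> \<open>x \<in> C, i.e. x \<le>_1 1; x must not contain variable (5,TZ)\<close>
  "inC x = FAll 5 TZ (leF (TApp x (TVar 5 TZ)) one)"

definition LOC_fm :: fm where
  "LOC_fm =
    (let F = TVar 1 T2; G = TVar 2 T2; f = TVar 1 T1; g = TVar 2 T1; i = TVar 1 TZ in
     FAll 1 T1 (FAll 2 T1 (FImp
        (FConj (inC f) (FConj (inC g)
           (FAll 1 TZ (FImp (ltF i (TApp G f)) (FEq (TApp g i) (TApp f i))))))
        (leF (TApp F g) (TApp G f)))))"

definition PITo :: fm where
  "PITo =
    (let F = TVar 1 T2; g = TVar 2 T1; N = TVar 0 TZ in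
     FAll 1 T2 (FAll 2 T2 (FEx 0 TZ (FImp LOC_fm
        (FAll 2 T1 (FImp (inC g) (leF (TApp F g) N)))))))"

end

theory Submission
  imports Defs "HOL-Library.Countable_Set" "HOL-Library.Nat_Bijection"
begin

text \<open>
  The model has a countable set \<open>X\<close> of type-1 objects, \<open>\<Sigma>\<^sup>1\<^sub>k\<close>-elementary in the set of
  all functions for every \<open>k\<close>, together with two type-2 functionals \<open>F\<close>, \<open>G\<close> on \<open>X\<close> satisfying
  \<open>LOC(F,G)\<close> with \<open>F\<close> unbounded on the Cantor space. They are built by forcing with countable
  partial functions \<open>f \<mapsto> (F f, G f)\<close> such that \<open>LOC\<close> holds, \<open>G\<close> is injective and \<open>F\<close> is bounded.
  A Tait computability argument shows that every closed term over \<open>F\<close>, \<open>G\<close>, \<open>\<mu>\<close>, the functionals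
  \<open>S\<^sub>k\<close> and arbitrary functions can be decided by extending a condition; countable closure of the
  forcing decides all values of a type-1 term at once, and that type-1 function is then added to
  the domain. Since \<open>G\<close> is injective, a diagonal argument always finds a binary \<open>g\<close> outside all
  neighbourhoods \<open>[f\<restriction>G(f)]\<close> promised so far, and there \<open>F\<close> may be given a larger value. The union of
  \<open>\<omega>\<close> such steps is the desired pair, and the higher types are the closed terms modulo extensional
  equality. The choice schema holds because \<open>\<mu>\<close> is present.
\<close>

section \<open>Truth of the normal form and Skolem functions\<close>

type_synonym real1 = "nat \<Rightarrow> nat"

definition pairN :: "nat \<Rightarrow> nat \<Rightarrow> nat" where
  "pairN a b = (a + b) * (a + b) + a"

fun barN :: "real1 \<Rightarrow> nat \<Rightarrow> nat" where
  "barN g 0 = 0"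
| "barN g (Suc n) = Suc (pairN (barN g n) (g n))"

fun tupN :: "nat list \<Rightarrow> nat" where
  "tupN [] = 0"
| "tupN [a] = a"
| "tupN (a # as) = pairN a (tupN as)"

text \<open>The argument \<open>r\<close> counts the quantifiers still to be read; the list holds the values of those
  already read, so its length determines the kind of the next quantifier.\<close>

fun sigma_holds :: "real1 set \<Rightarrow> real1 \<Rightarrow> nat \<Rightarrow> real1 list \<Rightarrow> bool" where
  "sigma_holds X f 0 gs =
     (if odd (length gs) then \<forall>n. f (tupN (map (\<lambda>g. barN g n) gs)) = 0
      else \<exists>n. f (tupN (map (\<lambda>g. barN g n) gs)) = 0)"
| "sigma_holds X f (Suc r) gs =
     (if even (length gs) then \<exists>g\<in>X. sigma_holds X f r (gs @ [g])
      else \<forall>g\<in>X. sigma_holds X f r (gs @ [g]))"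

text \<open>The head of \<open>fgs\<close> is the parameter \<open>f\<close>, its tail the functions
  already chosen. At an existential quantifier the tail has even length, so
  \<open>odd (length fgs)\<close> asks for a witness; otherwise a counterexample is chosen.\<close>

definition skolem :: "nat \<Rightarrow> real1 list \<Rightarrow> real1" where
  "skolem r fgs = (SOME g. sigma_holds UNIV (hd fgs) r (tl fgs @ [g]) = odd (length fgs))"

text \<open>A Tarski-Vaught argument: closure under \<open>skolem\<close> keeps witnesses and
  counterexamples in \<open>X\<close>, and the innermost quantifier ranges over numbers, so it has
  the same meaning on both sides.\<close>

lemma sigma_holds_elementary:
  assumes cl: "\<And>r gs. set gs \<subseteq> X \<Longrightarrow> skolem r gs \<in> X" and f: "f \<in> X"
  shows "set gs \<subseteq> X \<Longrightarrow> sigma_holds X f r gs = sigma_holds UNIV f r gs"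
proof (induction r arbitrary: gs)
  case 0
  show ?case by simp
next
  case (Suc r)
  have IH: "sigma_holds X f r (gs @ [g]) = sigma_holds UNIV f r (gs @ [g])" if "g \<in> X" for g
    using Suc that by simp
  have sk: "skolem r (f # gs) \<in> X" using cl f Suc.prems by simp
  have wit: "sigma_holds UNIV f r (gs @ [skolem r (f # gs)]) = even (length gs)"
    if "\<exists>g. sigma_holds UNIV f r (gs @ [g]) = even (length gs)"
    using someI_ex[OF that] by (simp add: skolem_def)
  show ?case
    by (cases "even (length gs)") (use IH sk wit in auto)
qed

section \<open>Closed terms and their evaluation relative to a partial oracle\<close>

datatype oracle_const = OF | OG | OMu | OSig nat

text \<open>The type of function constants is a parameter so that \<open>map_ct\<close> can rename
  them by numbers, which yields countability of the set of terms over a countable set.\<close>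

datatype 'a ct = Cst const | Fn 'a | Orc oracle_const | App "'a ct" "'a ct"

instance ftype :: countable by countable_datatype
instance const :: countable by countable_datatype
instance oracle_const :: countable by countable_datatype
instance ct :: (countable) countable by countable_datatype

type_synonym tm = "real1 ct"

lemma countable_terms_over:
  assumes "countable X"
  shows "countable {t :: 'a ct. set_ct t \<subseteq> X}"
proof -
  have "t = map_ct (from_nat_into X) (map_ct (to_nat_on X) t)" if "set_ct t \<subseteq> X" for t :: "'a ct"
    using that assms by (subst ct.map_comp, subst ct.map_cong0[where g = id]) (auto simp: ct.map_id)
  then have "{t :: 'a ct. set_ct t \<subseteq> X} \<subseteq> range (map_ct (from_nat_into X))" by blast
  then show ?thesis by (rule countable_subset) simp
qed

fun wt :: "'a ct \<Rightarrow> ftype \<Rightarrow> bool" where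
  "wt (Cst c) s = (s = ctype c)"
| "wt (Fn f) s = (s = T1)"
| "wt (Orc j) s = (s = T2)"
| "wt (App a b) s = (\<exists>r. wt a (TFn r s) \<and> wt b r)"

lemma wt_unique: "wt t s \<Longrightarrow> wt t s' \<Longrightarrow> s = s'"
proof (induction t arbitrary: s s')
  case (App a b)
  then obtain r r' where "wt a (TFn r s)" "wt a (TFn r' s')" by auto
  then show ?case using App.IH(1) by blast
qed auto

abbreviation recT :: "'a ct \<Rightarrow> 'a ct \<Rightarrow> 'a ct \<Rightarrow> 'a ct" where
  "recT x y z \<equiv> App (App (App (Cst CR) x) y) z"

fun num :: "nat \<Rightarrow> 'a ct" where
  "num 0 = Cst CZero"
| "num (Suc n) = App (Cst CSuc) (num n)"

lemma wt_num [simp]: "wt (num n) TZ" by (induction n) auto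
lemma set_num [simp]: "set_ct (num n) = {}" by (induction n) auto

section \<open>Oracles, weak head reduction and evaluation\<close>

type_synonym cnd = "real1 \<Rightarrow> (nat \<times> nat) option"

text \<open>Only \<open>OF\<close> and \<open>OG\<close> consult \<open>p\<close>. At a function
  without zeros \<open>OMu\<close> returns an unspecified number. \<open>OSig\<close> uses truth
  over all functions, which elementarity later transfers to the model.\<close>

fun orc :: "cnd \<Rightarrow> oracle_const \<Rightarrow> real1 \<Rightarrow> nat option" where
  "orc p OF f = map_option fst (p f)"
| "orc p OG f = map_option snd (p f)"
| "orc p OMu f = Some (LEAST n. f n = 0)"
| "orc p (OSig k) f = Some (if sigma_holds UNIV f k [] then 0 else 1)"

text \<open>Only the combinators reduce here; successor, recursor, function constants and oracles
  need evaluated arguments and belong to \<open>ev\<close>.\<close>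

inductive whr :: "'a ct \<Rightarrow> 'a ct \<Rightarrow> bool" where
  whr_K: "whr (App (App (Cst (CK r s)) a) b) a"
| whr_S: "whr (App (App (App (Cst (CS r s t)) a) b) c) (App (App a c) (App b c))"
| whr_App: "whr a a' \<Longrightarrow> whr (App a b) (App a' b)"

inductive_cases whr_AppE: "whr (App a b) t"
inductive_cases whr_CstE [elim!]: "whr (Cst c) t"
inductive_cases whr_FnE [elim!]: "whr (Fn c) t"
inductive_cases whr_OrcE [elim!]: "whr (Orc c) t"

lemma whr_det: "whr t a \<Longrightarrow> whr t b \<Longrightarrow> a = b"
proof (induction arbitrary: b rule: whr.induct)
  case (whr_K r s a b') then show ?case by (auto elim!: whr_AppE)
next
  case (whr_S r s t a b' c) then show ?case by (auto elim!: whr_AppE)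
next
  case (whr_App a a' b')
  from whr_App.prems show ?case
  proof (rule whr_AppE)
    fix a'' assume "b = App a'' b'" "whr a a''"
    then show ?thesis using whr_App.IH by blast
  qed (use whr_App.hyps in \<open>auto elim!: whr_AppE\<close>)
qed

text \<open>An infinitary relation: \<open>ev_orc\<close> has one premise for each numeral and so
  recovers the whole function denoted by the argument, while \<open>ev_recS\<close> restarts the
  recursion at a numeral for the predecessor.\<close>

inductive ev :: "cnd \<Rightarrow> tm \<Rightarrow> nat \<Rightarrow> bool" for p where
  ev_zero: "ev p (Cst CZero) 0"
| ev_suc: "ev p t n \<Longrightarrow> ev p (App (Cst CSuc) t) (Suc n)"
| ev_fn: "ev p t n \<Longrightarrow> ev p (App (Fn f) t) (f n)"
| ev_rec0: "ev p x 0 \<Longrightarrow> ev p y m \<Longrightarrow> ev p (recT x y z) m"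
| ev_recS: "ev p x (Suc k) \<Longrightarrow> ev p (App (App z (recT (num k) y z)) (num k)) m \<Longrightarrow> ev p (recT x y z) m"
| ev_orc: "(\<And>n. ev p (App t (num n)) (f n)) \<Longrightarrow> orc p j f = Some m \<Longrightarrow> ev p (App (Orc j) t) m"
| ev_whr: "whr t t' \<Longrightarrow> ev p t' n \<Longrightarrow> ev p t n"

inductive_cases ev_ZeroE: "ev p (Cst CZero) n"
inductive_cases ev_SucE: "ev p (App (Cst CSuc) t) n"
inductive_cases ev_FnE: "ev p (App (Fn f) t) n"
inductive_cases ev_RecE: "ev p (recT x y z) n"
inductive_cases ev_OrcE: "ev p (App (Orc j) t) n"

text \<open>A term with a head redex matches no other rule of \<open>ev\<close>, and reduction is
  deterministic, so every evaluation begins with this step.\<close>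

lemma ev_whr_iff:
  assumes "whr t t'"
  shows "ev p t n \<longleftrightarrow> ev p t' n"
proof
  assume "ev p t n"
  then show "ev p t' n"
    by (cases rule: ev.cases) (use assms whr_det in \<open>auto elim!: whr_AppE\<close>)
qed (use assms ev_whr in blast)

lemma ev_det: "ev p t n \<Longrightarrow> ev p t m \<Longrightarrow> m = n"
proof (induction arbitrary: m rule: ev.induct)
  case ev_zero then show ?case by (auto elim: ev_ZeroE)
next
  case (ev_suc t n)
  from ev_suc.prems show ?case
    by (rule ev_SucE) (use ev_suc.IH in \<open>auto elim!: whr_AppE\<close>)
next
  case (ev_fn t n f)
  from ev_fn.prems show ?case
    by (rule ev_FnE) (use ev_fn.IH in \<open>auto elim!: whr_AppE\<close>)
next
  case (ev_rec0 x y k z)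
  from ev_rec0.prems show ?case
    by (rule ev_RecE) (use ev_rec0.IH in \<open>auto elim!: whr_AppE\<close>)
next
  case (ev_recS x k z y k')
  from ev_recS.prems show ?case
    by (rule ev_RecE) (use ev_recS.IH in \<open>auto elim!: whr_AppE\<close>)
next
  case (ev_orc t f j k)
  from ev_orc.prems show ?case
  proof (rule ev_OrcE)
    fix f' assume a: "\<And>n. ev p (App t (num n)) (f' n)" "orc p j f' = Some m"
    have "f' = f" using ev_orc.IH a(1) by blast
    then show ?thesis using a(2) ev_orc by simp
  qed (auto elim!: whr_AppE)
next
  case (ev_whr t t' n)
  then show ?case using ev_whr_iff by blast
qed

lemma map_le_Some: "p \<subseteq>\<^sub>m q \<Longrightarrow> p f = Some y \<Longrightarrow> q f = Some y"
  by (metis domI map_le_def)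

lemma orc_mono: "p \<subseteq>\<^sub>m q \<Longrightarrow> orc p j f = Some m \<Longrightarrow> orc q j f = Some m"
  by (cases j) (auto dest: map_le_Some)

lemma ev_mono: "ev p t n \<Longrightarrow> p \<subseteq>\<^sub>m q \<Longrightarrow> ev q t n"
proof (induction rule: ev.induct)
  case (ev_orc t f j m)
  then show ?case using orc_mono ev.ev_orc by blast
qed (auto intro: ev.intros)

lemma ev_num: "ev p (num n) n"
  by (induction n) (auto intro: ev.intros)

text \<open>The recursion rules read the first argument only through its value, so it can be decided
  separately and replaced by a numeral.\<close>

lemma ev_rec_cong:
  assumes "ev p x k" "ev p (recT (num k) y z) m"
  shows "ev p (recT x y z) m"
  using assms(2)
proof (rule ev_RecE)
  assume a: "ev p (num k) 0" "ev p y m"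
  then have "k = 0" using ev_det[OF ev_num] by metis
  then show ?thesis using assms(1) a ev_rec0 by metis
next
  fix j assume a: "ev p (num k) (Suc j)" "ev p (App (App z (recT (num j) y z)) (num j)) m"
  then have "k = Suc j" using ev_det[OF ev_num] by metis
  then show ?thesis using assms(1) a ev_recS by metis
qed (auto elim!: whr_AppE)

section \<open>Forcing conditions\<close>

abbreviation supp :: "cnd \<Rightarrow> real1 set" where "supp p \<equiv> {f. p f \<noteq> None}"

text \<open>The value of a condition at \<open>f\<close> is the pair \<open>(F f, G f)\<close>.\<close>

definition cond :: "nat \<Rightarrow> cnd \<Rightarrow> bool" where
  "cond N p \<longleftrightarrow> countable (supp p)
     \<and> (\<forall>f a b. p f = Some (a, b) \<longrightarrow> a \<le> N \<and> 0 < b)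
     \<and> (\<forall>f g a b c. p f = Some (a, b) \<longrightarrow> p g = Some (c, b) \<longrightarrow> f = g)
     \<and> (\<forall>f g a b c d. p f = Some (a, b) \<longrightarrow> p g = Some (c, d) \<longrightarrow> (\<forall>i<b. g i = f i) \<longrightarrow> c \<le> b)"

lemma cond_bounds: "cond N p \<Longrightarrow> p f = Some (a, b) \<Longrightarrow> a \<le> N \<and> 0 < b"
  unfolding cond_def by blast

lemma cond_inj: "cond N p \<Longrightarrow> p f = Some (a, b) \<Longrightarrow> p g = Some (c, b) \<Longrightarrow> f = g"
  unfolding cond_def by blast

lemma cond_local_bound:
  "cond N p \<Longrightarrow> p f = Some (a, b) \<Longrightarrow> p g = Some (c, d) \<Longrightarrow> \<forall>i<b. g i = f i \<Longrightarrow> c \<le> b"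
  unfolding cond_def by blast

definition vals :: "cnd \<Rightarrow> nat set" where
  "vals p = {b. \<exists>f a. p f = Some (a, b)}"

text \<open>The set \<open>B\<close> reserves the values that \<open>G\<close> may take at new points. Splitting \<open>B\<close> into infinitely
  many infinite pieces lets an increasing sequence of conditions keep \<open>G\<close> injective in the limit
  without exhausting the available values.\<close>

definition dense_for :: "nat \<Rightarrow> (cnd \<Rightarrow> bool) \<Rightarrow> bool" where
  "dense_for N P \<longleftrightarrow> (\<forall>p B. cond N p \<longrightarrow> infinite B \<longrightarrow> B \<inter> vals p = {} \<longrightarrow>
     (\<exists>q. cond N q \<and> p \<subseteq>\<^sub>m q \<and> vals q \<subseteq> vals p \<union> B \<and> P q))"

definition upward :: "(cnd \<Rightarrow> bool) \<Rightarrow> bool" where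
  "upward P \<longleftrightarrow> (\<forall>p q. p \<subseteq>\<^sub>m q \<longrightarrow> P p \<longrightarrow> P q)"

section \<open>Countable closure of the forcing\<close>

lemma chain_union:
  fixes c :: "nat \<Rightarrow> cnd"
  assumes "\<And>i. c i \<subseteq>\<^sub>m c (Suc i)"
  obtains U where "\<And>i. c i \<subseteq>\<^sub>m U" "\<And>f y. U f = Some y \<Longrightarrow> \<exists>i. \<forall>j\<ge>i. c j f = Some y"
proof -
  have mono: "c i \<subseteq>\<^sub>m c j" if "i \<le> j" for i j
    using that by (induction j rule: dec_induct) (auto intro: map_le_trans assms)
  \<comment> \<open>The chain is increasing, so every stage defined at \<open>f\<close> gives the
    same value; the least one is a canonical choice.\<close>
  define U where "U f = (if \<exists>i. c i f \<noteq> None then c (LEAST i. c i f \<noteq> None) f else None)" for f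
  have least: "c (LEAST i. c i f \<noteq> None) f = Some y" if "c i f = Some y" for i f y
  proof -
    have "c (LEAST i. c i f \<noteq> None) f \<noteq> None" using LeastI[of "\<lambda>i. c i f \<noteq> None" i] that by simp
    moreover have "(LEAST i. c i f \<noteq> None) \<le> i" using Least_le[of "\<lambda>i. c i f \<noteq> None" i] that by simp
    ultimately obtain z where z: "c (LEAST i. c i f \<noteq> None) f = Some z"
      and le: "c (LEAST i. c i f \<noteq> None) \<subseteq>\<^sub>m c i" using mono by blast
    then have "c i f = Some z" using map_le_Some[OF le] by blast
    then show ?thesis using z that by simp
  qed
  show thesis
  proof (rule that[of U])
    have "U f = Some y" if "c i f = Some y" for i f y
    proof -
      have "c i f \<noteq> None" using that by simp
      then have "\<exists>i. c i f \<noteq> None" by blast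
      then show ?thesis using least[OF that] unfolding U_def by simp
    qed
    then show "c i \<subseteq>\<^sub>m U" for i
      unfolding map_le_def Map.dom_def by fastforce
    show "\<exists>i. \<forall>j\<ge>i. c j f = Some y" if "U f = Some y" for f y
    proof -
      obtain i where "c i f = Some y" using \<open>U f = Some y\<close> unfolding U_def by (metis option.distinct(1))
      then show ?thesis using map_le_Some[OF mono] by blast
    qed
  qed
qed

lemma split_infinite:
  fixes B :: "nat set"
  assumes "infinite B"
  obtains D :: "nat \<Rightarrow> nat set"
  where "\<And>i. infinite (D i)" "\<And>i. D i \<subseteq> B" "\<And>i j. i \<noteq> j \<Longrightarrow> D i \<inter> D j = {}"
proof -
  obtain f :: "nat \<Rightarrow> nat" where f: "inj f" "range f \<subseteq> B"
    using infinite_countable_subset[OF assms] by blast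
  show thesis
  proof (rule that[of "\<lambda>i. range (\<lambda>j. f (prod_encode (i, j)))"])
    show "infinite (range (\<lambda>j. f (prod_encode (i, j))))" for i
      using f(1) by (intro range_inj_infinite injI) (auto dest!: injD)
  qed (use f in \<open>auto simp: inj_eq\<close>)
qed

text \<open>Each clause on values concerns at most two points, and these appear together in one
  stage; the support is a countable union of countable sets.\<close>

lemma cond_chain:
  fixes c :: "nat \<Rightarrow> cnd"
  assumes c: "\<And>i. cond N (c i)"
    and U: "\<And>f y. U f = Some y \<Longrightarrow> \<exists>i. \<forall>j\<ge>i. c j f = Some y"
  shows "cond N U"
proof -
  have two: "\<exists>i. c i f = Some y \<and> c i g = Some z" if y: "U f = Some y" and z: "U g = Some z" for f g y z
  proof -
    from U[OF y] obtain i where "\<forall>k\<ge>i. c k f = Some y" ..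
    moreover from U[OF z] obtain j where "\<forall>k\<ge>j. c k g = Some z" ..
    ultimately have "c (max i j) f = Some y" "c (max i j) g = Some z" by simp_all
    then show ?thesis by blast
  qed
  have "supp U \<subseteq> (\<Union>i. supp (c i))"
  proof
    fix f assume "f \<in> supp U"
    then obtain y where "U f = Some y" by blast
    then obtain i where "c i f = Some y" using two by blast
    then have "f \<in> supp (c i)" by simp
    then show "f \<in> (\<Union>i. supp (c i))" by blast
  qed
  moreover have "countable (\<Union>i. supp (c i))" using c by (auto simp: cond_def)
  ultimately have "countable (supp U)" by (rule countable_subset)
  then show ?thesis
    unfolding cond_def
  proof (intro conjI allI impI)
    fix f a b assume "U f = Some (a, b)"
    then obtain i where "c i f = Some (a, b)" using two by blast
    then show "a \<le> N" "0 < b" using cond_bounds[OF c[of i]] by blast+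
  next
    fix f g a b d assume "U f = Some (a, b)" "U g = Some (d, b)"
    then obtain i where "c i f = Some (a, b)" "c i g = Some (d, b)" using two by blast
    then show "f = g" using cond_inj[OF c[of i]] by blast
  next
    fix f g a b d e assume "U f = Some (a, b)" "U g = Some (d, e)" and le: "\<forall>i<b. g i = f i"
    then obtain i where "c i f = Some (a, b)" "c i g = Some (d, e)" using two by blast
    then show "d \<le> b" using cond_local_bound[OF c[of i]] le by blast
  qed
qed

section \<open>Combining dense properties\<close>

lemma dense_for_trivial:
  assumes "\<And>q. P q"
  shows "dense_for N P"
  unfolding dense_for_def
proof (intro allI impI)
  fix p B assume "cond N p"
  then show "\<exists>q. cond N q \<and> p \<subseteq>\<^sub>m q \<and> vals q \<subseteq> vals p \<union> B \<and> P q"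
    using assms by (intro exI[of _ p]) simp
qed

lemma dense_for_weaken: "dense_for N P \<Longrightarrow> (\<And>q. P q \<Longrightarrow> Q q) \<Longrightarrow> dense_for N Q"
  unfolding dense_for_def by meson

text \<open>One piece of the reserve is spent on \<open>P\<close> and a disjoint piece on
  \<open>Q q\<close>, which may depend on the intermediate condition.\<close>

lemma dense_for_bind:
  assumes P: "dense_for N P" and Q: "\<And>q. P q \<Longrightarrow> dense_for N (Q q)"
    and R: "\<And>q q'. P q \<Longrightarrow> q \<subseteq>\<^sub>m q' \<Longrightarrow> Q q q' \<Longrightarrow> R q'"
  shows "dense_for N R"
  unfolding dense_for_def
proof (intro allI impI)
  fix p and B :: "nat set"
  assume p: "cond N p" and B: "infinite B" "B \<inter> vals p = {}"
  obtain D :: "nat \<Rightarrow> nat set" where D: "\<And>i. infinite (D i)" "\<And>i. D i \<subseteq> B"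
      "\<And>i j. i \<noteq> j \<Longrightarrow> D i \<inter> D j = {}"
    using split_infinite[OF B(1)] by metis
  have "D 0 \<inter> vals p = {}" using D(2) B(2) by blast
  then obtain q where q: "cond N q" "p \<subseteq>\<^sub>m q" "vals q \<subseteq> vals p \<union> D 0" "P q"
    using P p D(1) unfolding dense_for_def by meson
  have "D 1 \<inter> vals q = {}" using D(2)[of 1] D(3)[of 0 1] B(2) q(3) by auto
  then obtain q' where q': "cond N q'" "q \<subseteq>\<^sub>m q'" "vals q' \<subseteq> vals q \<union> D 1" "Q q q'"
    using Q[OF q(4)] q(1) D(1) unfolding dense_for_def by meson
  show "\<exists>q. cond N q \<and> p \<subseteq>\<^sub>m q \<and> vals q \<subseteq> vals p \<union> B \<and> R q"
    using q q' R D(2) map_le_trans by (intro exI[of _ q']) blast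
qed

text \<open>Fusion along a countable chain: step \<open>i\<close> spends only values from
  \<open>D i\<close>, so the later pieces stay free, and \<open>upward\<close> passes each property
  on to the union.\<close>

lemma dense_for_all_nat:
  assumes d: "\<And>i :: nat. dense_for N (P i)" and up: "\<And>i. upward (P i)"
  shows "dense_for N (\<lambda>q. \<forall>i. P i q)"
  unfolding dense_for_def
proof (intro allI impI)
  fix p and B :: "nat set"
  assume p: "cond N p" and B: "infinite B" "B \<inter> vals p = {}"
  obtain D :: "nat \<Rightarrow> nat set" where D: "\<And>i. infinite (D i)" "\<And>i. D i \<subseteq> B"
      "\<And>i j. i \<noteq> j \<Longrightarrow> D i \<inter> D j = {}"
    using split_infinite[OF B(1)] by metis
  let ?I = "\<lambda>i q. cond N q \<and> p \<subseteq>\<^sub>m q \<and> vals q \<subseteq> vals p \<union> (\<Union>j<i. D j)"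
  have "\<exists>c. \<forall>i. ?I i (c i) \<and> (c i \<subseteq>\<^sub>m c (Suc i) \<and> P i (c (Suc i)))"
  proof (rule dependent_nat_choice)
    show "\<exists>q. ?I 0 q" using p by auto
  next
    fix q i assume q: "?I i q"
    have "D i \<inter> D j = {}" if "j < i" for j using D(3)[of i j] that by simp
    then have "D i \<inter> (\<Union>j<i. D j) = {}" by blast
    then have "D i \<inter> vals q = {}" using q D(2)[of i] B(2) by blast
    then obtain q' where "cond N q'" "q \<subseteq>\<^sub>m q'" "vals q' \<subseteq> vals q \<union> D i" "P i q'"
      using d[of i, unfolded dense_for_def, rule_format, of q "D i"] q D(1) by auto
    moreover have "p \<subseteq>\<^sub>m q'" using q \<open>q \<subseteq>\<^sub>m q'\<close> map_le_trans by blast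
    moreover have "vals q' \<subseteq> vals p \<union> (\<Union>j<Suc i. D j)"
      using q \<open>vals q' \<subseteq> vals q \<union> D i\<close> by (auto simp: lessThan_Suc)
    ultimately show "\<exists>q'. ?I (Suc i) q' \<and> (q \<subseteq>\<^sub>m q' \<and> P i q')"
      by blast
  qed
  then obtain c where c: "\<And>i. ?I i (c i)" "\<And>i. c i \<subseteq>\<^sub>m c (Suc i)" "\<And>i. P i (c (Suc i))" by blast
  obtain U where U: "\<And>i. c i \<subseteq>\<^sub>m U" "\<And>f y. U f = Some y \<Longrightarrow> \<exists>i. \<forall>j\<ge>i. c j f = Some y"
    using chain_union[of c] c(2) by metis
  have "cond N U" using cond_chain[of N c U] c(1) U(2) by blast
  moreover have "p \<subseteq>\<^sub>m U" using c(1)[of 0] U(1)[of 0] map_le_trans by blast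
  moreover have "vals U \<subseteq> vals p \<union> B"
  proof
    fix b assume "b \<in> vals U"
    then obtain f a where "U f = Some (a, b)" by (auto simp: vals_def)
    then obtain i where "c i f = Some (a, b)" using U(2) by blast
    then have "b \<in> vals (c i)" by (auto simp: vals_def)
    then show "b \<in> vals p \<union> B" using c(1)[of i] D(2) by blast
  qed
  moreover have "\<forall>i. P i U" using c(3) U(1) up unfolding upward_def by blast
  ultimately show "\<exists>q. cond N q \<and> p \<subseteq>\<^sub>m q \<and> vals q \<subseteq> vals p \<union> B \<and> (\<forall>i. P i q)" by blast
qed

lemma dense_for_ball:
  assumes "countable S" and d: "\<And>i. i \<in> S \<Longrightarrow> dense_for N (P i)" and up: "\<And>i. upward (P i)"
  shows "dense_for N (\<lambda>q. \<forall>i\<in>S. P i q)"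
proof (cases "S = {}")
  case True
  then show ?thesis by (intro dense_for_trivial) simp
next
  case False
  have "dense_for N (\<lambda>q. \<forall>n. P (from_nat_into S n) q)"
    by (rule dense_for_all_nat) (rule d up from_nat_into[OF False])+
  then show ?thesis
  proof (rule dense_for_weaken)
    fix q assume a: "\<forall>n. P (from_nat_into S n) q"
    show "\<forall>i\<in>S. P i q"
    proof
      fix i assume "i \<in> S"
      then obtain n where "from_nat_into S n = i" using from_nat_into_surj[OF assms(1)] by blast
      then show "P i q" using a by blast
    qed
  qed
qed

text \<open>Locality could break in two ways. Around \<open>f\<close> it holds because
  \<open>n\<close> exceeds every first component; around old points it holds because
  \<open>f\<close> has first component \<open>0\<close> or lies outside all old
  neighbourhoods.\<close>

lemma cond_insert:
  assumes p: "cond N p" and "p f = None" "N \<le> M" "a \<le> M" "M < n" "n \<notin> vals p"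
    and nc: "a = 0 \<or> (\<forall>g c d. p g = Some (c, d) \<longrightarrow> \<not> (\<forall>i<d. f i = g i))"
  shows "cond M (p(f \<mapsto> (a, n)))"
proof -
  have "supp (p(f \<mapsto> (a, n))) = insert f (supp p)" by auto
  then have "countable (supp (p(f \<mapsto> (a, n))))" using p by (simp add: cond_def)
  moreover have bd: "c \<le> M \<and> 0 < d \<and> d \<noteq> n \<and> c < n" if "p g = Some (c, d)" for g c d
  proof -
    have "c \<le> N \<and> 0 < d" using cond_bounds[OF p that] .
    moreover have "d \<in> vals p" using that by (auto simp: vals_def)
    ultimately show ?thesis using assms by auto
  qed
  moreover have "g = h" if "p g = Some (c, d)" "p h = Some (e, d)" for g h c d e
    using cond_inj[OF p] that by blast
  moreover have "e \<le> d" if "p g = Some (c, d)" "p h = Some (e, k)" "\<forall>i<d. h i = g i" for g h c d e k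
    using cond_local_bound[OF p] that by blast
  moreover have "a \<le> d" if "p g = Some (c, d)" "\<forall>i<d. f i = g i" for g c d
    using nc that by (metis le0)
  ultimately show ?thesis
    unfolding cond_def using assms(4,5) by (auto split: if_splits dest: less_imp_le)
qed

lemma dense_for_supp: "dense_for N (\<lambda>q. q f \<noteq> None)"
  unfolding dense_for_def
proof (intro allI impI)
  fix p and B :: "nat set"
  assume p: "cond N p" and B: "infinite B" "B \<inter> vals p = {}"
  show "\<exists>q. cond N q \<and> p \<subseteq>\<^sub>m q \<and> vals q \<subseteq> vals p \<union> B \<and> q f \<noteq> None"
  proof (cases "p f = None")
    case False
    then show ?thesis using p by auto
  next
    case True
    \<comment> \<open>A first component \<open>0\<close> respects every neighbourhood containing
      \<open>f\<close>, so a fresh second component above \<open>N\<close> suffices.\<close>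
    obtain n where n: "n \<in> B" "N < n" using B(1) unfolding infinite_nat_iff_unbounded by blast
    then have "cond N (p(f \<mapsto> (0, n)))" using cond_insert[OF p True] B(2) by blast
    moreover have "p \<subseteq>\<^sub>m p(f \<mapsto> (0, n))" using True by (auto simp: map_le_def Map.dom_def)
    moreover have "vals (p(f \<mapsto> (0, n))) \<subseteq> vals p \<union> B" using n by (auto simp: vals_def)
    ultimately show ?thesis by (intro exI[of _ "p(f \<mapsto> (0, n))"]) simp
  qed
qed

lemma upward_supp: "upward (\<lambda>q. q f \<noteq> None)"
  unfolding upward_def by (auto simp: map_le_def Map.dom_def)

lemma upward_ev: "upward (\<lambda>q. \<exists>n. ev q t n)"
  unfolding upward_def using ev_mono by blast

section \<open>Every closed term is decided densely\<close>

text \<open>Tait's predicate with dense decidability at type 0. All bounds \<open>N\<close> are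
  required at once because the bound grows along the construction.\<close>

fun computable :: "ftype \<Rightarrow> tm \<Rightarrow> bool" where
  "computable TZ t = (\<forall>N. dense_for N (\<lambda>q. \<exists>n. ev q t n))"
| "computable (TFn r s) t = (\<forall>c. computable r c \<longrightarrow> computable s (App t c))"

lemma computable_TZ_weaken:
  assumes "computable TZ t" "\<And>q n. ev q t n \<Longrightarrow> \<exists>m. ev q t' m"
  shows "computable TZ t'"
  unfolding computable.simps
proof
  show "dense_for N (\<lambda>q. \<exists>n. ev q t' n)" for N
    by (rule dense_for_weaken[of N "\<lambda>q. \<exists>n. ev q t n"]) (use assms in auto)
qed

lemma computable_whr: "whr t t' \<Longrightarrow> computable s t' \<Longrightarrow> computable s t"
proof (induction s arbitrary: t t')
  case TZ
  from TZ(2) show ?case by (rule computable_TZ_weaken) (metis ev_whr TZ(1))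
next
  case (TFn r s)
  then show ?case using whr_App by (metis computable.simps(2))
qed

lemma computable_num: "computable TZ (num n)"
  unfolding computable.simps using ev_num by (intro allI dense_for_trivial) blast

text \<open>Fusion decides all values; the resulting function is then known and can be put into the
  domain of the condition, where every oracle is defined.\<close>

lemma dense_for_value:
  assumes "computable T1 t"
  shows "dense_for N (\<lambda>q. \<exists>f. q f \<noteq> None \<and> (\<forall>n. ev q (App t (num n)) (f n)))"
proof -
  have "dense_for N (\<lambda>q. \<forall>i. \<exists>n. ev q (App t (num i)) n)"
    using assms computable_num by (intro dense_for_all_nat upward_ev) simp
  then have "dense_for N (\<lambda>q. \<exists>f. \<forall>n. ev q (App t (num n)) (f n))"
    by (rule dense_for_weaken) metis
  then show ?thesis
  proof (rule dense_for_bind)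
    \<comment> \<open>The function depends on the condition deciding it, hence the second dense
      property is indexed by \<open>q\<close>.\<close>
    let ?f = "\<lambda>q. SOME f. \<forall>n. ev q (App t (num n)) (f n)"
    show "dense_for N (\<lambda>q'. q' (?f q) \<noteq> None)" for q by (rule dense_for_supp)
    fix q q' assume "\<exists>f. \<forall>n. ev q (App t (num n)) (f n)" "q \<subseteq>\<^sub>m q'" "q' (?f q) \<noteq> None"
    then show "\<exists>f. q' f \<noteq> None \<and> (\<forall>n. ev q' (App t (num n)) (f n))"
      using someI_ex[of "\<lambda>f. \<forall>n. ev q (App t (num n)) (f n)"] ev_mono by blast
  qed
qed

lemma computable_rec_num:
  assumes "computable TZ y" "computable (TFn TZ (TFn TZ TZ)) z"
  shows "computable TZ (recT (num k) y z)"
proof (induction k)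
  case 0
  show ?case by (rule computable_TZ_weaken[OF assms(1)]) (metis ev_rec0 ev_num)
next
  case (Suc k)
  then have "computable TZ (App (App z (recT (num k) y z)) (num k))"
    using assms(2) computable_num by simp
  then show ?case by (rule computable_TZ_weaken) (metis ev_recS ev_num)
qed

lemma computable_const: "computable (ctype c) (Cst c)"
proof (cases c)
  case CZero
  then show ?thesis using computable_num[of 0] by simp
next
  case CSuc
  have "computable TZ (App (Cst CSuc) t)" if "computable TZ t" for t
    using that by (rule computable_TZ_weaken) (rule exI, erule ev_suc)
  then show ?thesis using CSuc by simp
next
  case (CK r s)
  then show ?thesis using computable_whr[OF whr_K] by simp
next
  case (CS r s t)
  then show ?thesis using computable_whr[OF whr_S] by simp
next
  case CR
  have "dense_for N (\<lambda>q. \<exists>n. ev q (recT x y z) n)"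
    if "computable TZ x" "computable TZ y" "computable (TFn TZ (TFn TZ TZ)) z" for x y z N
  proof (rule dense_for_bind)
    show "dense_for N (\<lambda>q. \<exists>n. ev q x n)" using that by simp
    \<comment> \<open>The recursion is decided at the numeral of the value that \<open>q\<close>
      gives to \<open>x\<close>; this value is unique by \<open>ev_det\<close>.\<close>
    show "dense_for N (\<lambda>q'. \<exists>n. ev q' (recT (num (THE k. ev q x k)) y z) n)" for q
      using computable_rec_num that by simp
    fix q q' assume a: "\<exists>n. ev q x n" "q \<subseteq>\<^sub>m q'" "\<exists>n. ev q' (recT (num (THE k. ev q x k)) y z) n"
    then obtain k where k: "ev q x k" by blast
    then have "(THE k. ev q x k) = k" using ev_det by blast
    then show "\<exists>n. ev q' (recT x y z) n" using a k ev_rec_cong ev_mono by metis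
  qed
  then show ?thesis using CR by simp
qed

text \<open>Induction on terms. For an oracle, the condition is first extended until the argument
  denotes a function in its domain.\<close>

lemma wt_computable: "wt t s \<Longrightarrow> computable s t"
proof (induction t arbitrary: s)
  case (Cst c)
  then show ?case using computable_const by simp
next
  case (Fn f)
  have "computable TZ (App (Fn f) t)" if "computable TZ t" for t
    using that by (rule computable_TZ_weaken) (rule exI, erule ev_fn)
  then show ?case using Fn by simp
next
  case (Orc j)
  have "\<exists>m. ev q (App (Orc j) t) m" if "q f \<noteq> None" "\<forall>n. ev q (App t (num n)) (f n)" for q f t
  proof -
    have "orc q j f \<noteq> None" using that(1) by (cases j) simp_all
    then obtain m where m: "orc q j f = Some m" by blast
    have "ev q (App (Orc j) t) m" by (rule ev_orc[where f = f]) (use that(2) m in auto)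
    then show ?thesis ..
  qed
  then have "dense_for N (\<lambda>q. \<exists>m. ev q (App (Orc j) t) m)" if "computable T1 t" for t N
    using dense_for_weaken[OF dense_for_value[OF that, of N], of "\<lambda>q. \<exists>m. ev q (App (Orc j) t) m"] by blast
  then show ?case using Orc by simp
next
  case (App a b)
  then obtain r where "wt a (TFn r s)" "wt b r" by auto
  then show ?case using App.IH(1)[of "TFn r s"] App.IH(2)[of r] by simp
qed

section \<open>The generic oracle\<close>

text \<open>Bookkeeping between consecutive stages: what is built from functions present in
  \<open>p\<close> gets its value in \<open>q\<close>, so the union of the stages is closed.\<close>

definition stage_closed :: "cnd \<Rightarrow> cnd \<Rightarrow> bool" where
  "stage_closed p q \<longleftrightarrow>
     (\<forall>t. wt t T1 \<longrightarrow> set_ct t \<subseteq> supp p \<longrightarrow> (\<exists>f. q f \<noteq> None \<and> (\<forall>n. ev q (App t (num n)) (f n))))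
   \<and> (\<forall>r gs. set gs \<subseteq> supp p \<longrightarrow> q (skolem r gs) \<noteq> None)"

lemma upward_value: "upward (\<lambda>q. \<exists>f. q f \<noteq> None \<and> (\<forall>n. ev q (App t (num n)) (f n)))"
  unfolding upward_def
proof (intro allI impI)
  fix p q :: cnd
  assume le: "p \<subseteq>\<^sub>m q" and "\<exists>f. p f \<noteq> None \<and> (\<forall>n. ev p (App t (num n)) (f n))"
  then obtain f where f: "p f \<noteq> None" "\<forall>n. ev p (App t (num n)) (f n)" by blast
  have "q f \<noteq> None" using f(1) upward_supp le unfolding upward_def by blast
  moreover have "\<forall>n. ev q (App t (num n)) (f n)" using f(2) ev_mono[OF _ le] by blast
  ultimately show "\<exists>f. q f \<noteq> None \<and> (\<forall>n. ev q (App t (num n)) (f n))" by blast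
qed

text \<open>Only countably many terms and Skolem values arise from \<open>supp p\<close>, so fusion
  meets all requirements, first for the terms and then for the Skolem values.\<close>

lemma dense_for_stage_closed:
  assumes "countable (supp p)"
  shows "dense_for N (stage_closed p)"
proof -
  let ?S = "{t. wt t T1 \<and> set_ct t \<subseteq> supp p}" and ?A = "(\<lambda>(r, gs). skolem r gs) ` (UNIV \<times> lists (supp p))"
  let ?P = "\<lambda>t q. \<exists>f. q f \<noteq> None \<and> (\<forall>n. ev q (App t (num n)) (f n))"
  have "countable ?S" using countable_terms_over[OF assms] by (rule countable_subset[rotated]) auto
  then have 1: "dense_for N (\<lambda>q. \<forall>t\<in>?S. ?P t q)"
  proof (rule dense_for_ball)
    fix t assume "t \<in> ?S"
    then have "computable T1 t" using wt_computable by blast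
    then show "dense_for N (?P t)" by (rule dense_for_value)
  qed (rule upward_value)
  have "countable ?A" using assms by auto
  then have 2: "dense_for N (\<lambda>q. \<forall>f\<in>?A. q f \<noteq> None)"
    by (rule dense_for_ball) (rule dense_for_supp upward_supp)+
  show ?thesis
  proof (rule dense_for_bind[OF 1 2])
    fix q q' assume a: "\<forall>t\<in>?S. ?P t q" "q \<subseteq>\<^sub>m q'" "\<forall>f\<in>?A. q' f \<noteq> None"
    show "stage_closed p q'"
      unfolding stage_closed_def
    proof (intro conjI allI impI)
      fix t assume "wt t T1" "set_ct t \<subseteq> supp p"
      then have "?P t q" using a(1) by blast
      then show "?P t q'" using upward_value a(2) unfolding upward_def by blast
    next
      fix r gs assume "set gs \<subseteq> supp p"
      then have "skolem r gs \<in> ?A" by (intro image_eqI[of _ _ "(r, gs)"]) auto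
      then show "q' (skolem r gs) \<noteq> None" using a(3) by blast
    qed
  qed
qed

lemma stage_step:
  assumes p: "cond N p" and inf: "infinite (- vals p)"
  shows "\<exists>q. (cond (Suc N) q \<and> infinite (- vals q)) \<and> p \<subseteq>\<^sub>m q \<and> stage_closed p q
    \<and> (\<exists>g b. (\<forall>n. g n \<le> 1) \<and> q g = Some (Suc N, b))"
proof -
  \<comment> \<open>Second components are positive, hence of the form \<open>Suc i\<close>, and
    \<open>i\<close> is the last position that such a neighbourhood constrains; \<open>g\<close>
    differs there from the function owning it.\<close>
  define g where "g i = (if \<exists>f c. p f = Some (c, Suc i) \<and> f i = 0 then 1 else 0 :: nat)" for i
  \<comment> \<open>Injectivity of the second component makes this diagonalisation leave every neighbourhood.\<close>
  have nc: "\<not> (\<forall>i<d. g i = f i)" if f: "p f = Some (c, d)" for f c d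
  proof -
    obtain i where d: "d = Suc i" using cond_bounds[OF p f] by (cases d) auto
    have "f' = f" if "p f' = Some (c', Suc i)" for f' c'
      using cond_inj[OF p that] f d by blast
    then have "(\<exists>f' c'. p f' = Some (c', Suc i) \<and> f' i = 0) \<longleftrightarrow> f i = 0" using f d by blast
    then have "g i \<noteq> f i" by (simp add: g_def)
    then show ?thesis using d by blast
  qed
  have g: "p g = None"
  proof (cases "p g")
    case (Some y)
    then show ?thesis using nc[of g "fst y" "snd y"] by simp
  qed
  \<comment> \<open>\<open>D 0\<close> supplies the value at \<open>g\<close>, \<open>D 1\<close>
    serves the closing extension, and \<open>D 2\<close> stays untouched so that infinitely many
    values remain free.\<close>
  obtain D :: "nat \<Rightarrow> nat set" where D: "\<And>i. infinite (D i)" "\<And>i. D i \<subseteq> - vals p"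
      "\<And>i j. i \<noteq> j \<Longrightarrow> D i \<inter> D j = {}"
    using split_infinite[OF inf] by metis
  obtain n where n: "n \<in> D 0" "Suc N < n" using D(1)[of 0] unfolding infinite_nat_iff_unbounded by blast
  let ?p = "p(g \<mapsto> (Suc N, n))"
  have p': "cond (Suc N) ?p"
  proof (rule cond_insert[OF p g])
    show "n \<notin> vals p" using n D(2) by blast
    show "Suc N = 0 \<or> (\<forall>h c d. p h = Some (c, d) \<longrightarrow> \<not> (\<forall>i<d. g i = h i))" using nc by blast
  qed (use n in auto)
  have le: "p \<subseteq>\<^sub>m ?p" using g by (auto simp: map_le_def Map.dom_def)
  have v: "vals ?p \<subseteq> vals p \<union> D 0" using n by (auto simp: vals_def)
  have "D 1 \<inter> vals ?p = {}" using v D(2)[of 1] D(3)[of 0 1] by auto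
  moreover have "countable (supp p)" using p by (simp add: cond_def)
  ultimately obtain q where q: "cond (Suc N) q" "?p \<subseteq>\<^sub>m q" "vals q \<subseteq> vals ?p \<union> D 1" "stage_closed p q"
    using dense_for_stage_closed[of p "Suc N", unfolded dense_for_def, rule_format, OF _ p' D(1)[of 1]]
    by blast
  have "D 0 \<inter> D 2 = {}" "D 1 \<inter> D 2 = {}" by (simp_all add: D(3))
  then have "D 2 \<subseteq> - vals q" using v q(3) D(2)[of 2] by blast
  then have "infinite (- vals q)" using D(1) infinite_super by blast
  moreover have "q g = Some (Suc N, n)" using map_le_Some[OF q(2)] by simp
  moreover have "\<forall>n. g n \<le> 1" by (simp add: g_def)
  ultimately show ?thesis using q map_le_trans[OF le q(2)] by blast
qed

text \<open>These properties of the limit suffice to build the model. The limit satisfies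
  \<open>cond N\<close> for no \<open>N\<close>, since its first components are unbounded.\<close>

locale generic =
  fixes p :: cnd
  assumes countable_supp: "countable (supp p)"
    and decided: "\<And>t. wt t T1 \<Longrightarrow> set_ct t \<subseteq> supp p
        \<Longrightarrow> \<exists>f. p f \<noteq> None \<and> (\<forall>n. ev p (App t (num n)) (f n))"
    and skolem_closed: "\<And>r gs. set gs \<subseteq> supp p \<Longrightarrow> skolem r gs \<in> supp p"
    and local_bound: "\<And>f g a b c d. p f = Some (a, b) \<Longrightarrow> p g = Some (c, d)
        \<Longrightarrow> \<forall>i<b. g i = f i \<Longrightarrow> c \<le> b"
    and unbounded: "\<And>N. \<exists>g b. (\<forall>n. g n \<le> 1) \<and> p g = Some (Suc N, b)"

text \<open>Stage \<open>N\<close> is a condition with bound \<open>N\<close>, starting from the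
  empty one; \<open>stage_step\<close> raises the bound and closes under the functions
  present.\<close>

lemma generic_exists: "\<exists>p. generic p"
proof -
  let ?I = "\<lambda>N q. cond N q \<and> infinite (- vals q)"
  let ?R = "\<lambda>N p q. p \<subseteq>\<^sub>m q \<and> stage_closed p q \<and> (\<exists>g b. (\<forall>n. g n \<le> 1) \<and> q g = Some (Suc N, b))"
  have "\<exists>c. \<forall>N. ?I N (c N) \<and> ?R N (c N) (c (Suc N))"
  proof (rule dependent_nat_choice[of ?I ?R])
    have "cond 0 Map.empty" by (simp add: cond_def)
    moreover have "vals Map.empty = {}" by (simp add: vals_def)
    ultimately show "\<exists>q. ?I 0 q" by (intro exI[of _ Map.empty]) simp
  next
    show "\<exists>q. ?I (Suc N) q \<and> ?R N p q" if "?I N p" for p N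
      by (rule stage_step) (use that in simp_all)
  qed
  then obtain c where c0: "\<forall>N. ?I N (c N) \<and> ?R N (c N) (c (Suc N))" ..
  have c: "\<And>N. cond N (c N)" "\<And>N. c N \<subseteq>\<^sub>m c (Suc N)"
      "\<And>N. stage_closed (c N) (c (Suc N))"
      "\<And>N. \<exists>g b. (\<forall>n. g n \<le> 1) \<and> c (Suc N) g = Some (Suc N, b)"
    using c0 by simp_all
  obtain U where U: "\<And>i. c i \<subseteq>\<^sub>m U" "\<And>f y. U f = Some y \<Longrightarrow> \<exists>i. \<forall>j\<ge>i. c j f = Some y"
    using chain_union[of c] c(2) by metis
  \<comment> \<open>A term or a list mentions finitely many functions, which all lie in one stage;
    the next stage then treats it.\<close>
  have fin: "\<exists>i. A \<subseteq> supp (c i)" if "finite A" "A \<subseteq> supp U" for A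
    using that
  proof (induction A rule: finite_induct)
    case (insert f A)
    then obtain i y where i: "A \<subseteq> supp (c i)" "U f = Some y" by auto
    from U(2)[OF i(2)] obtain j where j: "\<forall>k\<ge>j. c k f = Some y" ..
    have "c i \<subseteq>\<^sub>m c (max i j)"
      using max.cobounded1[of i j] by (induction rule: dec_induct) (auto intro: map_le_trans c(2))
    then have "supp (c i) \<subseteq> supp (c (max i j))" by (auto simp: map_le_def Map.dom_def)
    moreover have "c (max i j) f = Some y" using j by simp
    ultimately show ?case using i(1) by (intro exI[of _ "max i j"]) auto
  qed simp
  have supp_le: "supp (c i) \<subseteq> supp U" for i using U(1)[of i] by (auto simp: map_le_def Map.dom_def)
  have fin_ct: "finite (set_ct t)" for t :: tm by (induction t) auto
  show ?thesis
  proof (intro exI[of _ U] generic.intro)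
    have "supp U \<subseteq> (\<Union>i. supp (c i))"
    proof
      fix f assume "f \<in> supp U"
      then obtain y where "U f = Some y" by blast
      then obtain i where "c i f = Some y" using U(2) by blast
      then have "f \<in> supp (c i)" by simp
      then show "f \<in> (\<Union>i. supp (c i))" by blast
    qed
    moreover have "countable (\<Union>i. supp (c i))" using c(1) by (auto simp: cond_def)
    ultimately show "countable (supp U)" by (rule countable_subset)
  next
    fix t assume t: "wt t T1" "set_ct t \<subseteq> supp U"
    then obtain i where "set_ct t \<subseteq> supp (c i)" using fin fin_ct by blast
    then obtain f where "c (Suc i) f \<noteq> None" "\<forall>n. ev (c (Suc i)) (App t (num n)) (f n)"
      using c(3)[of i] t(1) unfolding stage_closed_def by blast
    then show "\<exists>f. U f \<noteq> None \<and> (\<forall>n. ev U (App t (num n)) (f n))"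
      using ev_mono[OF _ U(1)] supp_le by blast
  next
    fix r gs assume "set gs \<subseteq> supp U"
    then obtain i where "set gs \<subseteq> supp (c i)" using fin by blast
    then show "skolem r gs \<in> supp U" using c(3)[of i] supp_le unfolding stage_closed_def by blast
  next
    fix f g a b d e assume a: "U f = Some (a, b)" "U g = Some (d, e)" "\<forall>i<b. g i = f i"
    from U(2)[OF a(1)] obtain i where "\<forall>k\<ge>i. c k f = Some (a, b)" ..
    moreover from U(2)[OF a(2)] obtain j where "\<forall>k\<ge>j. c k g = Some (d, e)" ..
    ultimately have "c (max i j) f = Some (a, b)" "c (max i j) g = Some (d, e)" by simp_all
    then show "d \<le> b" using cond_local_bound[OF c(1)[of "max i j"]] a(3) by blast
  next
    show "\<exists>g b. (\<forall>n. g n \<le> 1) \<and> U g = Some (Suc N, b)" for N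
      using c(4)[of N] map_le_Some[OF U(1)] by blast
  qed
qed

section \<open>The term model\<close>

context generic
begin

section \<open>Closed terms over the generic domain and their extensional equality\<close>

definition T :: "ftype \<Rightarrow> tm set" where
  "T s = {t. wt t s \<and> set_ct t \<subseteq> supp p}"

lemma T_App: "a \<in> T (TFn r s) \<Longrightarrow> b \<in> T r \<Longrightarrow> App a b \<in> T s"
  by (auto simp: T_def)

lemma T_num [simp]: "num n \<in> T TZ" by (simp add: T_def)
lemma T_Cst: "s = ctype c \<Longrightarrow> Cst c \<in> T s" by (simp add: T_def)
lemma T_Fn: "f \<in> supp p \<Longrightarrow> Fn f \<in> T T1" by (simp add: T_def)
lemma T_Orc: "Orc j \<in> T T2" by (simp add: T_def)

lemma T_rec:
  "x \<in> T TZ \<Longrightarrow> y \<in> T TZ \<Longrightarrow> z \<in> T (TFn TZ (TFn TZ TZ)) \<Longrightarrow> recT x y z \<in> T TZ"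
  by (intro T_App T_Cst | simp)+

text \<open>A logical relation rather than pointwise equality, so that application respects it by
  definition; reflexivity on \<open>T\<close> then becomes a theorem about terms.\<close>

fun E :: "ftype \<Rightarrow> tm \<Rightarrow> tm \<Rightarrow> bool" where
  "E TZ a b = (\<exists>n. ev p a n \<and> ev p b n)"
| "E (TFn r s) a b = (\<forall>c\<in>T r. \<forall>d\<in>T r. E r c d \<longrightarrow> E s (App a c) (App b d))"

lemma E_sym: "E s a b \<Longrightarrow> E s b a"
  by (induction s arbitrary: a b) (simp, blast, simp)

lemma E_trans: "E s a b \<Longrightarrow> E s b c \<Longrightarrow> E s a c"
proof (induction s arbitrary: a b c)
  case TZ
  then show ?case using ev_det by (metis E.simps(1))
next
  case (TFn r s)
  show ?case
    unfolding E.simps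
  proof (intro ballI impI)
    fix u v assume uv: "u \<in> T r" "v \<in> T r" "E r u v"
    \<comment> \<open>Symmetry and transitivity at the argument type stand in for reflexivity, which
      is proved only later.\<close>
    have "E r v v" using TFn.IH(1)[OF E_sym[OF uv(3)] uv(3)] .
    then have "E s (App b v) (App c v)" using TFn.prems(2) uv by simp
    moreover have "E s (App a u) (App b v)" using TFn.prems(1) uv by simp
    ultimately show "E s (App a u) (App c v)" using TFn.IH(2) by blast
  qed
qed

lemma E_whr: "whr a a' \<Longrightarrow> E s a' b \<Longrightarrow> E s a b"
proof (induction s arbitrary: a a' b)
  case TZ
  then show ?case using ev_whr by (metis E.simps(1))
next
  case (TFn r s)
  show ?case
    unfolding E.simps
  proof (intro ballI impI)
    fix u v assume uv: "u \<in> T r" "v \<in> T r" "E r u v"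
    then have "E s (App a' u) (App b v)" using TFn.prems(2) by simp
    then show "E s (App a u) (App b v)" using TFn.IH(2) whr_App[OF TFn.prems(1)] by blast
  qed
qed

lemma E_whr2: "whr a a' \<Longrightarrow> whr b b' \<Longrightarrow> E s a' b' \<Longrightarrow> E s a b"
  by (meson E_whr E_sym)

lemma E_FnI:
  "(\<And>c d. c \<in> T r \<Longrightarrow> d \<in> T r \<Longrightarrow> E r c d \<Longrightarrow> E s (App a c) (App b d)) \<Longrightarrow> E (TFn r s) a b"
  by simp

lemma E_FnD: "E (TFn r s) a b \<Longrightarrow> c \<in> T r \<Longrightarrow> d \<in> T r \<Longrightarrow> E r c d \<Longrightarrow> E s (App a c) (App b d)"
  by simp

lemma E_num: "E TZ (num n) (num n)"
  using ev_num by auto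

lemma E_rec_num:
  assumes "y \<in> T TZ" "y' \<in> T TZ" "z \<in> T (TFn TZ (TFn TZ TZ))" "z' \<in> T (TFn TZ (TFn TZ TZ))"
    and y: "E TZ y y'" and z: "E (TFn TZ (TFn TZ TZ)) z z'"
  shows "E TZ (recT (num k) y z) (recT (num k) y' z')"
proof (induction k)
  case 0
  from y obtain m where "ev p y m" "ev p y' m" by auto
  then show ?case using ev_rec0[OF ev_num[of p 0]] unfolding E.simps by blast
next
  case (Suc k)
  have "E TZ (App (App z (recT (num k) y z)) (num k)) (App (App z' (recT (num k) y' z')) (num k))"
    by (rule E_FnD[OF E_FnD[OF z]]) (use assms Suc in \<open>auto simp del: E.simps intro: T_rec E_num\<close>)
  then show ?case using ev_recS[OF ev_num] unfolding E.simps by blast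
qed

lemma E_const: "E (ctype c) (Cst c) (Cst c)"
proof (cases c)
  case CZero
  then show ?thesis using E_num[of 0] by simp
next
  case CSuc
  then show ?thesis using ev_suc by fastforce
next
  case (CK r s)
  then show ?thesis
    by (simp only: ctype.simps) (intro E_FnI, rule E_whr2[OF whr_K whr_K])
next
  case (CS r s t)
  have "E t (App (App x u) (App y u)) (App (App x' u') (App y' u'))"
    if "E (TFn r (TFn s t)) x x'" "E (TFn r s) y y'" "E r u u'" "u \<in> T r" "u' \<in> T r"
      "y \<in> T (TFn r s)" "y' \<in> T (TFn r s)" for x x' y y' u u'
    by (rule E_FnD[OF E_FnD[OF that(1)]]) (use that T_App E_FnD[OF that(2)] in blast)+
  then show ?thesis
    unfolding CS ctype.simps by (intro E_FnI) (rule E_whr2[OF whr_S whr_S])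
next
  case CR
  show ?thesis
    unfolding CR ctype.simps
  proof (intro E_FnI)
    fix x x' y y' z z'
    assume a: "x \<in> T TZ" "x' \<in> T TZ" "E TZ x x'" "y \<in> T TZ" "y' \<in> T TZ" "E TZ y y'"
      "z \<in> T (TFn TZ (TFn TZ TZ))" "z' \<in> T (TFn TZ (TFn TZ TZ))" "E (TFn TZ (TFn TZ TZ)) z z'"
    obtain k where k: "ev p x k" "ev p x' k" using a(3) by auto
    have "E TZ (recT (num k) y z) (recT (num k) y' z')" using a E_rec_num by blast
    then show "E TZ (recT x y z) (recT x' y' z')"
      using ev_rec_cong[OF k(1)] ev_rec_cong[OF k(2)] unfolding E.simps by blast
  qed
qed

lemma T1_value:
  assumes "t \<in> T T1"
  obtains f where "f \<in> supp p" "\<And>n. ev p (App t (num n)) (f n)"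
  using decided[of t] assms unfolding T_def by blast

lemma orc_defined: "f \<in> supp p \<Longrightarrow> orc p j f = Some (the (orc p j f))"
  by (cases j) auto

text \<open>By genericity \<open>a\<close> denotes a function in \<open>supp p\<close>; a related
  \<open>b\<close> has the same values at all numerals, so the oracle receives the same
  function.\<close>

lemma E_orc: "E T2 (Orc j) (Orc j)"
proof (rule E_FnI)
  fix a b assume a: "a \<in> T T1" "E T1 a b"
  obtain f where f: "f \<in> supp p" "\<And>n. ev p (App a (num n)) (f n)" using T1_value[OF a(1)] by metis
  have "ev p (App b (num n)) (f n)" for n
  proof -
    have "E TZ (App a (num n)) (App b (num n))" using E_FnD[OF a(2)] E_num by simp
    then show ?thesis using f(2)[of n] ev_det by (metis E.simps(1))
  qed
  then show "E TZ (App (Orc j) a) (App (Orc j) b)"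
    using ev_orc[OF _ orc_defined[OF f(1)]] f(2) unfolding E.simps by blast
qed

text \<open>The fundamental lemma of the logical relation: all constants are related to themselves,
  and application preserves the relation.\<close>

lemma E_refl: "t \<in> T s \<Longrightarrow> E s t t"
proof (induction t arbitrary: s)
  case (Cst c)
  then show ?case using E_const by (simp add: T_def)
next
  case (Fn f)
  have "E T1 (Fn f) (Fn f)" using ev_fn by fastforce
  then show ?case using Fn by (simp add: T_def)
next
  case (Orc j)
  then show ?case using E_orc by (simp add: T_def)
next
  case (App a b)
  then obtain r where "a \<in> T (TFn r s)" "b \<in> T r" by (auto simp: T_def)
  then show ?case using App.IH E_FnD by blast
qed

text \<open>Reflexivity of \<open>b\<close> carries pointwise equality over to related arguments;
  this makes the model extensional.\<close>

lemma E_Fn_iff: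
  assumes "b \<in> T (TFn r s)"
  shows "E (TFn r s) a b \<longleftrightarrow> (\<forall>c\<in>T r. E s (App a c) (App b c))"
proof
  assume R: "\<forall>c\<in>T r. E s (App a c) (App b c)"
  show "E (TFn r s) a b"
  proof (rule E_FnI)
    fix c d assume "c \<in> T r" "d \<in> T r" "E r c d"
    then show "E s (App a c) (App b d)" using R E_FnD[OF E_refl[OF assms]] E_trans by blast
  qed
qed (use E_refl E_FnD in blast)

section \<open>Coding classes of terms by natural numbers\<close>

lemma T_unique: "t \<in> T s \<Longrightarrow> t \<in> T s' \<Longrightarrow> s = s'"
  using wt_unique by (auto simp: T_def)

text \<open>Membership carries a type, so well-typed terms of different types never share a class
  and the domains of the model are disjoint.\<close>

definition cls :: "tm \<Rightarrow> tm set" where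
  "cls t = {u. \<exists>s. t \<in> T s \<and> u \<in> T s \<and> E s t u}"

definition code :: "tm \<Rightarrow> nat" where
  "code t = to_nat_on (cls ` (\<Union>s. T s)) (cls t)"

lemma code_eq_iff:
  assumes a: "a \<in> T s" and b: "b \<in> T s'"
  shows "code a = code b \<longleftrightarrow> s = s' \<and> E s a b"
proof -
  have "(\<Union>s. T s) \<subseteq> {t. set_ct t \<subseteq> supp p}" by (auto simp: T_def)
  then have "countable (\<Union>s. T s)" using countable_terms_over[OF countable_supp] by (rule countable_subset)
  then have "countable (cls ` (\<Union>s. T s))" by (rule countable_image)
  then have "code a = code b \<longleftrightarrow> cls a = cls b"
    unfolding code_def by (rule to_nat_on_inj) (use a b in blast)+
  also have "\<dots> \<longleftrightarrow> s = s' \<and> E s a b"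
  proof
    assume "cls a = cls b"
    moreover have "b \<in> cls b" unfolding cls_def using b E_refl by blast
    ultimately obtain r where "a \<in> T r" "b \<in> T r" "E r a b" unfolding cls_def by blast
    then show "s = s' \<and> E s a b" using a b T_unique by metis
  next
    assume ab: "s = s' \<and> E s a b"
    then have "E r a u \<longleftrightarrow> E r b u" if "a \<in> T r" for r u
      using that T_unique[OF a that] E_sym E_trans by blast
    moreover have "a \<in> T r \<longleftrightarrow> b \<in> T r" for r using ab a b T_unique by metis
    ultimately show "cls a = cls b" unfolding cls_def by blast
  qed
  finally show ?thesis .
qed

definition dec :: "nat \<Rightarrow> tm" where
  "dec x = (SOME t. t \<in> (\<Union>s. T s) \<and> code t = x)"

lemma dec_code:
  assumes "a \<in> T s"
  shows "dec (code a) \<in> T s" "E s (dec (code a)) a"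
proof -
  have "dec (code a) \<in> (\<Union>s. T s) \<and> code (dec (code a)) = code a"
    unfolding dec_def by (rule someI[of _ a]) (use assms in blast)
  then obtain r where "dec (code a) \<in> T r" "code (dec (code a)) = code a" by blast
  then show "dec (code a) \<in> T s" "E s (dec (code a)) a" using code_eq_iff[OF _ assms] by blast+
qed

definition M :: "nat str" where
  "M = \<lparr>dom = \<lambda>s. code ` T s, ap = \<lambda>x y. code (App (dec x) (dec y)), cst = \<lambda>c. code (Cst c)\<rparr>"

text \<open>Independence of the chosen representatives, because \<open>E\<close> is a
  congruence.\<close>

lemma ap_code:
  assumes "a \<in> T (TFn r s)" "b \<in> T r"
  shows "ap M (code a) (code b) = code (App a b)"
proof -
  note d = dec_code[OF assms(1)] dec_code[OF assms(2)]
  have "E s (App (dec (code a)) (dec (code b))) (App a b)" using E_FnD d assms by blast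
  then have "code (App (dec (code a)) (dec (code b))) = code (App a b)"
    using code_eq_iff[OF T_App[OF d(1,3)] T_App[OF assms]] by simp
  then show ?thesis by (simp add: M_def)
qed

lemma dom_M: "dom M s = code ` T s" by (simp add: M_def)
lemma cst_M: "cst M c = code (Cst c)" by (simp add: M_def)

lemma ap_dom [intro]: "f \<in> dom M (TFn s t) \<Longrightarrow> x \<in> dom M s \<Longrightarrow> ap M f x \<in> dom M t"
  using ap_code T_App unfolding dom_M by (auto intro!: image_eqI)

lemma cst_dom: "cst M c \<in> dom M (ctype c)"
  unfolding dom_M cst_M using T_Cst by blast

section \<open>Numbers, functions and constants in the model\<close>

definition nm :: "nat \<Rightarrow> nat" where "nm n = code (num n)"
definition fn :: "real1 \<Rightarrow> nat" where "fn f = code (Fn f)"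

lemma code_TZ: "t \<in> T TZ \<Longrightarrow> ev p t n \<Longrightarrow> code t = nm n"
proof -
  assume t: "t \<in> T TZ" "ev p t n"
  then have "E TZ t (num n)" unfolding E.simps using ev_num by blast
  then show ?thesis unfolding nm_def using code_eq_iff[OF t(1) T_num] by blast
qed

lemma T_TZ_value: "t \<in> T TZ \<Longrightarrow> \<exists>n. ev p t n"
  using E_refl[of t TZ] by auto

lemma dom_TZ: "dom M TZ = range nm"
proof
  show "dom M TZ \<subseteq> range nm" using T_TZ_value code_TZ unfolding dom_M by blast
  show "range nm \<subseteq> dom M TZ" unfolding dom_M nm_def using T_num by blast
qed

lemma nm_eq [simp]: "nm m = nm n \<longleftrightarrow> m = n"
proof
  assume "nm m = nm n"
  then obtain k where "ev p (num m) k" "ev p (num n) k"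
    using code_eq_iff[OF T_num T_num, of m n] unfolding nm_def by auto
  then show "m = n" using ev_det ev_num by blast
qed simp

lemma nm_dom [simp]: "nm n \<in> dom M TZ" by (simp add: dom_TZ)

lemma fn_dom: "f \<in> supp p \<Longrightarrow> fn f \<in> dom M T1"
  unfolding dom_M fn_def using T_Fn by blast

text \<open>By genericity a term of type 1 has its value function in \<open>supp p\<close>, and it
  is extensionally equal to the constant for that function.\<close>

lemma dom_T1: "dom M T1 = fn ` supp p"
proof
  show "dom M T1 \<subseteq> fn ` supp p"
  proof
    fix x assume "x \<in> dom M T1"
    then obtain t where t: "t \<in> T T1" "x = code t" unfolding dom_M by blast
    obtain f where f: "f \<in> supp p" "\<And>n. ev p (App t (num n)) (f n)" using T1_value[OF t(1)] by metis
    have "E TZ (App t c) (App (Fn f) c)" if c: "c \<in> T TZ" for c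
    proof -
      obtain k where k: "ev p c k" using T_TZ_value[OF c] by blast
      \<comment> \<open>Values of \<open>t\<close> are known at numerals only, so an arbitrary
        argument is replaced by the numeral of its value.\<close>
      then have "E TZ c (num k)" using ev_num by auto
      then have "E TZ (App t c) (App t (num k))" using E_FnD[OF E_refl[OF t(1)]] c by simp
      then have "ev p (App t c) (f k)" using ev_det f(2)[of k] by (metis E.simps(1))
      then show ?thesis using ev_fn[OF k] by auto
    qed
    then have "E T1 t (Fn f)" using E_Fn_iff[OF T_Fn[OF f(1)]] by blast
    then have "x = fn f" using t code_eq_iff[OF t(1) T_Fn[OF f(1)]] unfolding fn_def by blast
    then show "x \<in> fn ` supp p" using f(1) by blast
  qed
qed (use fn_dom in blast)

lemma ap_fn [simp]: "f \<in> supp p \<Longrightarrow> ap M (fn f) (nm n) = nm (f n)"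
  using ap_code[OF T_Fn T_num] code_TZ[OF T_App[OF T_Fn T_num] ev_fn[OF ev_num]]
  unfolding fn_def nm_def by simp

lemma cst_zero: "cst M CZero = nm 0" by (simp add: cst_M nm_def)

lemma ap_suc [simp]: "ap M (cst M CSuc) (nm n) = nm (Suc n)"
  using ap_code[OF T_Cst T_num, of TZ CSuc n] by (simp add: cst_M nm_def)

lemma ap_orc: "f \<in> supp p \<Longrightarrow> ap M (code (Orc j)) (fn f) = nm (the (orc p j f))"
proof -
  assume f: "f \<in> supp p"
  have "ev p (App (Orc j) (Fn f)) (the (orc p j f))"
    by (rule ev_orc[OF _ orc_defined[OF f]]) (intro ev_fn ev_num)
  then show ?thesis
    unfolding fn_def using ap_code[OF T_Orc T_Fn[OF f]] code_TZ[OF T_App[OF T_Orc T_Fn[OF f]]] by simp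
qed

lemma ap_K [simp]:
  assumes "x \<in> dom M r" "y \<in> dom M s"
  shows "ap M (ap M (cst M (CK r s)) x) y = x"
proof -
  obtain a b where a: "a \<in> T r" "x = code a" and b: "b \<in> T s" "y = code b"
    using assms unfolding dom_M by blast
  have K: "Cst (CK r s) \<in> T (TFn r (TFn s r))" by (rule T_Cst) simp
  have "E r (App (App (Cst (CK r s)) a) b) a" using E_whr[OF whr_K] E_refl a(1) by blast
  then have "code (App (App (Cst (CK r s)) a) b) = code a"
    using code_eq_iff[OF T_App[OF T_App[OF K a(1)] b(1)] a(1)] by blast
  then show ?thesis
    using ap_code[OF K a(1)] ap_code[OF T_App[OF K a(1)] b(1)] a b by (simp add: cst_M)
qed

lemma ap_S [simp]:
  assumes "x \<in> dom M (TFn r (TFn s t))" "y \<in> dom M (TFn r s)" "z \<in> dom M r"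
  shows "ap M (ap M (ap M (cst M (CS r s t)) x) y) z = ap M (ap M x z) (ap M y z)"
proof -
  obtain a b c where a: "a \<in> T (TFn r (TFn s t))" "x = code a" and b: "b \<in> T (TFn r s)" "y = code b"
    and c: "c \<in> T r" "z = code c"
    using assms unfolding dom_M by blast
  let ?K = "Cst (CS r s t)"
  have K: "?K \<in> T (TFn (TFn r (TFn s t)) (TFn (TFn r s) (TFn r t)))" by (rule T_Cst) simp
  note K1 = T_App[OF K a(1)] and K2 = T_App[OF T_App[OF K a(1)] b(1)]
  note ac = T_App[OF a(1) c(1)] and bc = T_App[OF b(1) c(1)]
  have "E t (App (App (App ?K a) b) c) (App (App a c) (App b c))"
    using E_whr[OF whr_S] E_refl[OF T_App[OF ac bc]] by blast
  then have "code (App (App (App ?K a) b) c) = code (App (App a c) (App b c))"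
    using code_eq_iff[OF T_App[OF K2 c(1)] T_App[OF ac bc]] by blast
  then show ?thesis
    using ap_code[OF K a(1)] ap_code[OF K1 b(1)] ap_code[OF K2 c(1)] ap_code[OF a(1) c(1)]
      ap_code[OF b(1) c(1)] ap_code[OF ac bc] a b c by (simp add: cst_M)
qed

lemma ap_rec:
  assumes "y \<in> dom M TZ" "z \<in> dom M (TFn TZ (TFn TZ TZ))"
  shows "ap M (ap M (ap M (cst M CR) (nm 0)) y) z = y" (is ?A)
    and "ap M (ap M (ap M (cst M CR) (nm (Suc n))) y) z
       = ap M (ap M z (ap M (ap M (ap M (cst M CR) (nm n)) y) z)) (nm n)" (is ?B)
proof -
  obtain b c where b: "b \<in> T TZ" "y = code b" and c: "c \<in> T (TFn TZ (TFn TZ TZ))" "z = code c"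
    using assms unfolding dom_M by blast
  have K: "Cst CR \<in> T (TFn TZ (TFn TZ (TFn (TFn TZ (TFn TZ TZ)) TZ)))" by (rule T_Cst) simp
  have rec: "ap M (ap M (ap M (cst M CR) (nm k)) y) z = code (recT (num k) b c)" for k
    using ap_code[OF K T_num, of k] ap_code[OF T_App[OF K T_num] b(1), of k]
      ap_code[OF T_App[OF T_App[OF K T_num] b(1)] c(1), of k] b c
    by (simp add: cst_M nm_def)
  note Tr = T_rec[OF T_num b(1) c(1)]
  obtain m where m: "ev p b m" using T_TZ_value[OF b(1)] by blast
  have "ev p (recT (num 0) b c) m" using ev_rec0[OF ev_num[of p 0] m] .
  then show ?A using rec[of 0] code_TZ[OF Tr, of 0 m] code_TZ[OF b(1) m] b by simp
  have T': "App (App c (recT (num n) b c)) (num n) \<in> T TZ" by (intro T_App[OF T_App[OF c(1) Tr]] T_num)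
  then obtain k where k: "ev p (App (App c (recT (num n) b c)) (num n)) k" using T_TZ_value by blast
  then have "ev p (recT (num (Suc n)) b c) k" using ev_recS[OF ev_num] by blast
  then have "code (recT (num (Suc n)) b c) = code (App (App c (recT (num n) b c)) (num n))"
    using code_TZ[OF Tr, of "Suc n" k] code_TZ[OF T' k] by simp
  then show ?B
    using rec ap_code[OF c(1) Tr, of n] ap_code[OF T_App[OF c(1) Tr] T_num, of n n] c
    by (simp add: nm_def del: num.simps)
qed

text \<open>Codes already identify extensionally equal terms, so the extensionality axiom reduces to
  substitution of equals.\<close>

lemma exteq_M: "x \<in> dom M s \<Longrightarrow> y \<in> dom M s \<Longrightarrow> exteq M s x y \<longleftrightarrow> x = y"
proof (induction s arbitrary: x y)
  case (TFn r s)
  obtain a b where a: "a \<in> T (TFn r s)" "x = code a" and b: "b \<in> T (TFn r s)" "y = code b"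
    using TFn.prems unfolding dom_M by blast
  have "exteq M (TFn r s) x y \<longleftrightarrow> (\<forall>z\<in>dom M r. ap M x z = ap M y z)"
    using TFn.IH(2) TFn.prems ap_dom by simp
  also have "\<dots> \<longleftrightarrow> (\<forall>c\<in>T r. code (App a c) = code (App b c))"
    using a b ap_code unfolding dom_M by simp
  also have "\<dots> \<longleftrightarrow> (\<forall>c\<in>T r. E s (App a c) (App b c))"
    using code_eq_iff T_App[OF a(1)] T_App[OF b(1)] by blast
  also have "\<dots> \<longleftrightarrow> x = y"
    using E_Fn_iff[OF b(1)] code_eq_iff[OF a(1) b(1)] a b by blast
  finally show ?case .
qed simp

lemma is_str_M: "is_str M"
  unfolding is_str_def
proof (intro conjI allI impI)
  show "dom M s \<noteq> {}" for s
  proof (induction s)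
    case TZ
    then show ?case by (simp add: dom_TZ)
  next
    case (TFn r s)
    then obtain x where "x \<in> dom M s" by blast
    then have "ap M (cst M (CK s r)) x \<in> dom M (TFn r s)"
      using cst_dom[of "CK s r"] ap_dom by simp
    then show ?case by blast
  qed
qed (use ap_dom cst_dom in auto)

end

section \<open>Definable operations and the axioms in the model\<close>

lemma ty_TApp: "ty (TApp u v) = Some s \<longleftrightarrow> (\<exists>r. ty u = Some (TFn r s) \<and> ty v = Some r)"
  by (auto split: option.splits ftype.splits)

lemma ty_absn: "ty t = Some u \<Longrightarrow> ty (absn n s t) = Some (TFn s u)"
proof (induction t arbitrary: u)
  case (TApp a b)
  then obtain r where "ty a = Some (TFn r u)" "ty b = Some r" unfolding ty_TApp by blast
  then show ?case using TApp.IH by simp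
qed (auto simp: Icomb_def)

lemma ty_absn_simp [simp]: "ty t \<noteq> None \<Longrightarrow> ty (absn n s t) = map_option (TFn s) (ty t)"
  using ty_absn by fastforce

lemma upd_apply: "upd e n s x m t = (if m = n \<and> t = s then x else e m t)"
  by (simp add: upd_def)

declare absn.simps [simp del]

context generic
begin

lemma adm_upd: "adm M e \<Longrightarrow> x \<in> dom M s \<Longrightarrow> adm M (upd e n s x)"
  by (simp add: adm_def upd_apply)

lemma eval_dom: "adm M e \<Longrightarrow> ty t = Some s \<Longrightarrow> eval M e t \<in> dom M s"
proof (induction t arbitrary: s)
  case (TApp a b)
  then obtain r where "ty a = Some (TFn r s)" "ty b = Some r" unfolding ty_TApp by blast
  then show ?case using TApp ap_dom by simp
qed (use cst_dom in \<open>auto simp: adm_def\<close>)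

lemma eval_TZ: "adm M e \<Longrightarrow> ty t = Some TZ \<Longrightarrow> \<exists>n. eval M e t = nm n"
  using eval_dom[of e t TZ] unfolding dom_TZ by blast

lemma K_dom: "cst M (CK r s) \<in> dom M (TFn r (TFn s r))"
  using cst_dom[of "CK r s"] by simp

lemma S_dom: "cst M (CS r s t) \<in> dom M (TFn (TFn r (TFn s t)) (TFn (TFn r s) (TFn r t)))"
  using cst_dom[of "CS r s t"] by simp

text \<open>The beta rule for bracket abstraction. Typing enters because \<open>absn\<close> reads
  the type of the function part to choose the indices of \<open>CS\<close>.\<close>

lemma eval_absn:
  assumes e: "adm M e" and x: "x \<in> dom M s"
  shows "ty t = Some u \<Longrightarrow> ap M (eval M e (absn n s t)) x = eval M (upd e n s x) t"
proof (induction t arbitrary: u)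
  case (TVar m s')
  have v: "e m s' \<in> dom M s'" using e by (simp add: adm_def)
  have "ap M (eval M e (Icomb s)) x = x"
    unfolding Icomb_def using x K_dom ap_dom[OF K_dom x] by simp
  then show ?case using x v by (simp add: upd_apply absn.simps)
next
  case (TCst c)
  show ?case using x cst_dom[of c] by (simp add: absn.simps)
next
  case (TApp a b)
  then obtain r where ab: "ty a = Some (TFn r u)" "ty b = Some r" unfolding ty_TApp by blast
  have "eval M e (absn n s a) \<in> dom M (TFn s (TFn r u))" "eval M e (absn n s b) \<in> dom M (TFn s r)"
    using eval_dom[OF e] ty_absn ab by blast+
  then show ?case using ab TApp.IH x by (simp add: absn.simps)
qed

text \<open>Typability replaces a named type, which the simplifier would have to guess.\<close>

lemma ap_eval_absn [simp]:
  "adm M e \<Longrightarrow> x \<in> dom M s \<Longrightarrow> ty t \<noteq> None \<Longrightarrow> ap M (eval M e (absn n s t)) x = eval M (upd e n s x) t"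
  using eval_absn by blast

text \<open>The recursor passes the previous value first and the index second,
  \<open>rec_nat\<close> the reverse; hence the swapped arguments of \<open>h\<close>.\<close>

lemma ap_rec_nat:
  assumes z: "z \<in> dom M (TFn TZ (TFn TZ TZ))" and h: "\<And>a b. ap M (ap M z (nm a)) (nm b) = nm (h a b)"
  shows "ap M (ap M (ap M (cst M CR) (nm n)) (nm m)) z = nm (rec_nat m (\<lambda>b a. h a b) n)"
  by (induction n) (simp_all add: ap_rec[OF nm_dom z] h)

lemma eval_lR:
  assumes "adm M e" "ty (comp z) = Some (TFn TZ (TFn TZ TZ))"
    and "eval M e (comp x) = nm n" "eval M e (comp y) = nm m"
    and "\<And>a b. ap M (ap M (eval M e (comp z)) (nm a)) (nm b) = nm (h a b)"
  shows "eval M e (comp (lR x y z)) = nm (rec_nat m (\<lambda>b a. h a b) n)"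
  using ap_rec_nat[OF eval_dom[OF assms(1,2)] assms(5)] assms(3,4) by (simp add: lR_def)

lemma ty_lR [simp]:
  "ty (comp x) = Some TZ \<Longrightarrow> ty (comp y) = Some TZ \<Longrightarrow> ty (comp z) = Some (TFn TZ (TFn TZ TZ))
    \<Longrightarrow> ty (comp (lR x y z)) = Some TZ"
  by (simp add: lR_def)

section \<open>Arithmetic and sequence codes as terms\<close>

lemma ty_predL [simp]: "ty (comp predL) = Some (TFn TZ TZ)"
  by (simp add: predL_def)

lemma eval_predL [simp]:
  assumes "adm M e"
  shows "ap M (eval M e (comp predL)) (nm n) = nm (n - 1)"
proof -
  have "ap M (eval M e (comp predL)) (nm n)
      = eval M (upd e 1 TZ (nm n)) (comp (lR (LV 1 TZ) (LC CZero) (LL 2 TZ (LL 3 TZ (LV 3 TZ)))))"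
    unfolding predL_def using assms by simp
  also have "\<dots> = nm (rec_nat 0 (\<lambda>b a. b) n)"
    by (rule eval_lR) (use assms in \<open>simp_all add: adm_upd upd_apply cst_zero\<close>)
  also have "rec_nat 0 (\<lambda>b a. b) n = n - 1" by (cases n) simp_all
  finally show ?thesis .
qed

lemma ty_monusL [simp]: "ty (comp monusL) = Some (TFn TZ (TFn TZ TZ))"
  by (simp add: monusL_def)

lemma eval_monusL [simp]:
  assumes "adm M e"
  shows "ap M (ap M (eval M e (comp monusL)) (nm m)) (nm n) = nm (m - n)"
proof -
  have "ap M (ap M (eval M e (comp monusL)) (nm m)) (nm n)
      = eval M (upd (upd e 1 TZ (nm m)) 2 TZ (nm n))
          (comp (lR (LV 2 TZ) (LV 1 TZ) (LL 3 TZ (LL 4 TZ (LA predL (LV 3 TZ))))))"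
    unfolding monusL_def using assms by (simp add: adm_upd)
  also have "\<dots> = nm (rec_nat m (\<lambda>b a. a - 1) n)"
    by (rule eval_lR) (use assms in \<open>simp_all add: adm_upd upd_apply cst_zero\<close>)
  also have "rec_nat m (\<lambda>b a. a - 1) n = m - n" by (induction n) simp_all
  finally show ?thesis .
qed

lemma ty_addL [simp]: "ty (comp addL) = Some (TFn TZ (TFn TZ TZ))"
  by (simp add: addL_def)

lemma eval_addL [simp]:
  assumes "adm M e"
  shows "ap M (ap M (eval M e (comp addL)) (nm m)) (nm n) = nm (m + n)"
proof -
  have "ap M (ap M (eval M e (comp addL)) (nm m)) (nm n)
      = eval M (upd (upd e 1 TZ (nm m)) 2 TZ (nm n))
          (comp (lR (LV 2 TZ) (LV 1 TZ) (LL 3 TZ (LL 4 TZ (LA (LC CSuc) (LV 3 TZ))))))"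
    unfolding addL_def using assms by (simp add: adm_upd)
  also have "\<dots> = nm (rec_nat m (\<lambda>b a. Suc a) n)"
    by (rule eval_lR) (use assms in \<open>simp_all add: adm_upd upd_apply cst_zero\<close>)
  also have "rec_nat m (\<lambda>b a. Suc a) n = m + n" by (induction n) simp_all
  finally show ?thesis .
qed

lemma ty_mulL [simp]: "ty (comp mulL) = Some (TFn TZ (TFn TZ TZ))"
  by (simp add: mulL_def lApp2_def)

lemma eval_mulL [simp]:
  assumes "adm M e"
  shows "ap M (ap M (eval M e (comp mulL)) (nm m)) (nm n) = nm (m * n)"
proof -
  have "ap M (ap M (eval M e (comp mulL)) (nm m)) (nm n)
      = eval M (upd (upd e 1 TZ (nm m)) 2 TZ (nm n))
          (comp (lR (LV 2 TZ) (LC CZero) (LL 3 TZ (LL 4 TZ (lApp2 addL (LV 3 TZ) (LV 1 TZ))))))"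
    unfolding mulL_def using assms by (simp add: adm_upd lApp2_def)
  also have "\<dots> = nm (rec_nat 0 (\<lambda>b a. a + m) n)"
    by (rule eval_lR) (use assms in \<open>simp_all add: adm_upd upd_apply cst_zero lApp2_def\<close>)
  also have "rec_nat 0 (\<lambda>b a. a + m) n = m * n" by (induction n) simp_all
  finally show ?thesis .
qed

lemma ty_pairL [simp]: "ty (comp a) = Some TZ \<Longrightarrow> ty (comp b) = Some TZ \<Longrightarrow> ty (comp (pairL a b)) = Some TZ"
  by (simp add: pairL_def Let_def lApp2_def)

lemma eval_pairL [simp]:
  "adm M e \<Longrightarrow> eval M e (comp a) = nm x \<Longrightarrow> eval M e (comp b) = nm y
    \<Longrightarrow> eval M e (comp (pairL a b)) = nm (pairN x y)"
  by (simp add: pairL_def Let_def lApp2_def pairN_def)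

lemma ty_barL [simp]: "ty (comp (barL (LV j T1) (LV i TZ))) = Some TZ"
  by (simp add: barL_def)

text \<open>No capture occurs for any \<open>j\<close>: variables are identified by number and type
  together, and the bound ones have type \<open>TZ\<close>.\<close>

lemma eval_barL:
  assumes "adm M e" "g \<in> supp p" "e j T1 = fn g" "e i TZ = nm n"
  shows "eval M e (comp (barL (LV j T1) (LV i TZ))) = nm (barN g n)"
proof -
  have "eval M e (comp (barL (LV j T1) (LV i TZ))) = nm (rec_nat 0 (\<lambda>b a. Suc (pairN a (g b))) n)"
    unfolding barL_def
  proof (rule eval_lR)
    fix a b
    let ?e = "upd (upd e 1001 TZ (nm a)) 1002 TZ (nm b)"
    have "adm M ?e" using assms(1) by (simp add: adm_upd)
    moreover have "eval M ?e (comp (LV 1001 TZ)) = nm a" by (simp add: upd_apply)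
    moreover have "eval M ?e (comp (LA (LV j T1) (LV 1002 TZ))) = nm (g b)"
      using assms by (simp add: upd_apply)
    ultimately have "eval M ?e (comp (pairL (LV 1001 TZ) (LA (LV j T1) (LV 1002 TZ)))) = nm (pairN a (g b))"
      by (rule eval_pairL)
    then show "ap M (ap M (eval M e (comp (LL 1001 TZ (LL 1002 TZ (LA (LC CSuc)
        (pairL (LV 1001 TZ) (LA (LV j T1) (LV 1002 TZ)))))))) (nm a)) (nm b) = nm (Suc (pairN a (g b)))"
      using assms(1) by (simp add: adm_upd)
  qed (use assms in \<open>simp_all add: cst_zero\<close>)
  also have "rec_nat 0 (\<lambda>b a. Suc (pairN a (g b))) n = barN g n" by (induction n) simp_all
  finally show ?thesis .
qed

lemma eval_tupL:
  assumes "adm M e" "list_all2 (\<lambda>u n. ty (comp u) = Some TZ \<and> eval M e (comp u) = nm n) us ns"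
  shows "ty (comp (tupL us)) = Some TZ" "eval M e (comp (tupL us)) = nm (tupN ns)"
proof -
  have "ty (comp (tupL us)) = Some TZ \<and> eval M e (comp (tupL us)) = nm (tupN ns)"
    using assms(2)
  proof (induction us arbitrary: ns rule: tupL.induct)
    case (3 u v us)
    then obtain n m ns' where ns: "ns = n # m # ns'" by (auto simp: list_all2_Cons1)
    have "ty (comp (tupL (v # us))) = Some TZ \<and> eval M e (comp (tupL (v # us))) = nm (tupN (m # ns'))"
      by (rule "3.IH") (use "3.prems" ns in simp)
    then show ?case using eval_pairL[OF assms(1)] "3.prems" ns by simp
  qed (auto simp: cst_zero list_all2_Cons1)
  then show "ty (comp (tupL us)) = Some TZ" "eval M e (comp (tupL us)) = nm (tupN ns)" by auto
qed

section \<open>The normal form evaluated in the model\<close>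

lemma sat_sigma_matrix:
  assumes e: "adm M e" "e 0 T1 = fn f" "f \<in> supp p" "e 0 TZ = nm n"
    and gs: "set gs \<subseteq> supp p" "\<And>j. j < length gs \<Longrightarrow> e (Suc j) T1 = fn (gs ! j)"
  shows "sat M e (FEq (TApp (TVar 0 T1)
      (comp (tupL (map (\<lambda>j. barL (LV j T1) (LV 0 TZ)) [1..<length gs + 1])))) (TCst CZero))
    \<longleftrightarrow> f (tupN (map (\<lambda>g. barN g n) gs)) = 0"
proof -
  have "list_all2 (\<lambda>u n. ty (comp u) = Some TZ \<and> eval M e (comp u) = nm n)
      (map (\<lambda>j. barL (LV j T1) (LV 0 TZ)) [1..<length gs + 1]) (map (\<lambda>g. barN g n) gs)"
    unfolding list_all2_conv_all_nth
  proof (intro conjI allI impI)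
    fix i assume "i < length (map (\<lambda>j. barL (LV j T1) (LV 0 TZ)) [1..<length gs + 1])"
    then have i: "i < length gs" by (simp del: upt_Suc)
    then have "[1..<length gs + 1] ! i = Suc i" by (simp del: upt_Suc)
    moreover have "gs ! i \<in> supp p" using gs(1) i nth_mem by blast
    ultimately show "eval M e (comp (map (\<lambda>j. barL (LV j T1) (LV 0 TZ)) [1..<length gs + 1] ! i))
        = nm (map (\<lambda>g. barN g n) gs ! i)"
      using eval_barL[OF e(1) _ gs(2)[OF i] e(4)] i by (simp del: upt_Suc)
  qed (simp_all del: upt_Suc)
  from eval_tupL(2)[OF e(1) this] show ?thesis using e by (simp add: cst_zero)
qed

text \<open>Induction on the quantifiers still unread, with \<open>gs\<close> interpreting those
  already read. The next variable is \<open>length gs + 1\<close>, odd exactly when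
  \<open>length gs\<close> is even, which aligns the two parity conventions.\<close>

lemma sat_sigma_fold:
  assumes "adm M e" "e 0 T1 = fn f" "f \<in> supp p" "set gs \<subseteq> supp p"
    "\<And>j. j < length gs \<Longrightarrow> e (Suc j) T1 = fn (gs ! j)" "k = length gs + r"
  shows "sat M e (foldr (\<lambda>j A. if odd j then FEx j T1 A else FAll j T1 A) [length gs + 1..<k + 1]
      (let mat = FEq (TApp (TVar 0 T1)
                  (comp (tupL (map (\<lambda>j. barL (LV j T1) (LV 0 TZ)) [1..<k+1])))) (TCst CZero)
       in if odd k then FAll 0 TZ mat else FEx 0 TZ mat))
    \<longleftrightarrow> sigma_holds (supp p) f r gs"
  using assms
proof (induction r arbitrary: gs e)
  case 0
  have "sat M (upd e 0 TZ (nm n)) (FEq (TApp (TVar 0 T1)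
      (comp (tupL (map (\<lambda>j. barL (LV j T1) (LV 0 TZ)) [1..<length gs + 1])))) (TCst CZero))
    \<longleftrightarrow> f (tupN (map (\<lambda>g. barN g n) gs)) = 0" for n
    by (rule sat_sigma_matrix[OF adm_upd[OF 0(1) nm_dom]]) (use 0 in \<open>simp_all add: upd_apply\<close>)
  then show ?case using "0.prems"(6) by (simp add: dom_TZ del: sat.simps(1) upt_Suc)
next
  case (Suc r)
  let ?B = "let mat = FEq (TApp (TVar 0 T1)
                  (comp (tupL (map (\<lambda>j. barL (LV j T1) (LV 0 TZ)) [1..<k+1])))) (TCst CZero)
       in if odd k then FAll 0 TZ mat else FEx 0 TZ mat"
  let ?Q = "\<lambda>j A. if odd j then FEx j T1 A else FAll j T1 A"
  have IH: "sat M (upd e (length gs + 1) T1 (fn g)) (foldr ?Q [length gs + 2..<k + 1] ?B)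
      \<longleftrightarrow> sigma_holds (supp p) f r (gs @ [g])" if g: "g \<in> supp p" for g
  proof -
    have "sat M (upd e (length gs + 1) T1 (fn g)) (foldr ?Q [length (gs @ [g]) + 1..<k + 1] ?B)
      \<longleftrightarrow> sigma_holds (supp p) f r (gs @ [g])"
    proof (rule Suc.IH[OF adm_upd[OF Suc.prems(1) fn_dom[OF g]]])
      fix j assume "j < length (gs @ [g])"
      then show "upd e (length gs + 1) T1 (fn g) (Suc j) T1 = fn ((gs @ [g]) ! j)"
        using Suc.prems(5)[of j] by (auto simp: upd_apply nth_append)
    qed (use Suc.prems g in \<open>simp_all add: upd_apply\<close>)
    then show ?thesis by simp
  qed
  have "[length gs + 1..<k + 1] = (length gs + 1) # [length gs + 2..<k + 1]"
    using Suc.prems(6) by (simp add: upt_conv_Cons del: upt_Suc)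
  then show ?case using IH by (simp add: dom_T1 del: upt_Suc)
qed

text \<open>Quantifiers of the model range over \<open>supp p\<close>, while \<open>OSig\<close>
  refers to all functions; closure under \<open>skolem\<close> reconciles the two.\<close>

lemma sat_sigma_fm:
  assumes "adm M e" "e 0 T1 = fn f" "f \<in> supp p"
  shows "sat M e (sigma_fm k) \<longleftrightarrow> sigma_holds UNIV f k []"
proof -
  have "sat M e (sigma_fm k) \<longleftrightarrow> sigma_holds (supp p) f k []"
    using sat_sigma_fold[OF assms, of "[]" k k] unfolding sigma_fm_def Let_def by simp
  also have "\<dots> \<longleftrightarrow> sigma_holds UNIV f k []"
    by (rule sigma_holds_elementary[OF skolem_closed assms(3)]) simp_all
  finally show ?thesis .
qed

lemma sat_leF:
  "adm M e \<Longrightarrow> eval M e a = nm x \<Longrightarrow> eval M e b = nm y \<Longrightarrow> sat M e (leF a b) \<longleftrightarrow> x \<le> y"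
  by (simp add: leF_def cst_zero)

lemma eval_one: "eval M e one = nm 1"
  by (simp add: one_def cst_zero)

lemma Orc_dom: "code (Orc j) \<in> dom M T2"
  unfolding dom_M using T_Orc by blast

lemma valid_Sk_ax: "valid M (Sk_ax k)"
  unfolding valid_def
proof (intro allI impI)
  fix e assume e: "adm M e"
  let ?e = "\<lambda>f. upd (upd e 0 T2 (code (Orc (OSig k)))) 0 T1 (fn f)"
  have adm: "adm M (?e f)" if "f \<in> supp p" for f
    using e that by (simp add: adm_upd Orc_dom fn_dom)
  have val: "eval M (?e f) (TApp (TVar 0 T2) (TVar 0 T1)) = nm (if sigma_holds UNIV f k [] then 0 else 1)"
    if "f \<in> supp p" for f
    using that by (simp add: upd_apply ap_orc)
  have "sat M (?e f) (leF (TApp (TVar 0 T2) (TVar 0 T1)) one)" if "f \<in> supp p" for f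
    using sat_leF[OF adm[OF that] val[OF that] eval_one] by simp
  moreover have "sat M (?e f) (FEq (TApp (TVar 0 T2) (TVar 0 T1)) (TCst CZero)) \<longleftrightarrow> sat M (?e f) (sigma_fm k)"
    if "f \<in> supp p" for f
    using sat_sigma_fm[OF adm[OF that] _ that] val[OF that] by (simp add: upd_apply cst_zero)
  ultimately show "sat M e (Sk_ax k)"
    unfolding Sk_ax_def FIff_def by (auto simp: dom_T1 intro!: bexI[OF _ Orc_dom[of "OSig k"]] simp del: sat.simps(1))
qed

section \<open>Characteristic terms and quantifier-free choice\<close>

definition represents :: "trm \<Rightarrow> fm \<Rightarrow> bool" where
  "represents t A \<longleftrightarrow> ty t = Some TZ \<and>
     (\<forall>e. adm M e \<longrightarrow> (\<exists>n. eval M e t = nm n \<and> (n = 0 \<longleftrightarrow> sat M e A)))"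

text \<open>Zero stands for truth: conjunction becomes a sum, disjunction a product, and equality
  the sum of both truncated differences.\<close>

lemma characteristic_term: "qf A \<Longrightarrow> wf_fm A \<Longrightarrow> \<exists>t. represents t A"
proof (induction A)
  case (FEq u v)
  let ?d = "\<lambda>u v. TApp (TApp (comp monusL) u) v"
  let ?t = "TApp (TApp (comp addL) (?d u v)) (?d v u)"
  have uv: "ty u = Some TZ" "ty v = Some TZ" using FEq.prems by simp_all
  have "\<exists>n. eval M e ?t = nm n \<and> (n = 0 \<longleftrightarrow> sat M e (FEq u v))" if e: "adm M e" for e
  proof -
    obtain x y where "eval M e u = nm x" "eval M e v = nm y"
      using eval_TZ[OF e uv(1)] eval_TZ[OF e uv(2)] by blast
    then show ?thesis using e by (intro exI[of _ "x - y + (y - x)"]) auto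
  qed
  moreover have "ty ?t = Some TZ" using uv by simp
  ultimately show ?case unfolding represents_def by blast
next
  case FBot
  have "ty one = Some TZ" by (simp add: one_def)
  then show ?case unfolding represents_def using eval_one by (intro exI[of _ one]) simp
next
  case (FConj A B)
  obtain s where s: "represents s A" using FConj.IH(1) FConj.prems by auto
  obtain t where t: "represents t B" using FConj.IH(2) FConj.prems by auto
  let ?t = "TApp (TApp (comp addL) s) t"
  have "ty ?t = Some TZ" using s t by (simp add: represents_def one_def)
  moreover have "\<exists>n. eval M e ?t = nm n \<and> (n = 0 \<longleftrightarrow> sat M e (FConj A B))" if e: "adm M e" for e
  proof -
    obtain x y where xy: "eval M e s = nm x" "x = 0 \<longleftrightarrow> sat M e A" "eval M e t = nm y" "y = 0 \<longleftrightarrow> sat M e B"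
      using s t e unfolding represents_def by metis
    have "eval M e ?t = nm (x + y)" using e xy(1,3) by (simp add: eval_one)
    moreover have "x + y = 0 \<longleftrightarrow> sat M e (FConj A B)" unfolding sat.simps xy(2,4)[symmetric] by auto
    ultimately show ?thesis by (intro exI[of _ "x + y"] conjI)
  qed
  ultimately show ?case unfolding represents_def by blast
next
  case (FDisj A B)
  obtain s where s: "represents s A" using FDisj.IH(1) FDisj.prems by auto
  obtain t where t: "represents t B" using FDisj.IH(2) FDisj.prems by auto
  let ?t = "TApp (TApp (comp mulL) s) t"
  have "ty ?t = Some TZ" using s t by (simp add: represents_def one_def)
  moreover have "\<exists>n. eval M e ?t = nm n \<and> (n = 0 \<longleftrightarrow> sat M e (FDisj A B))" if e: "adm M e" for e
  proof -
    obtain x y where xy: "eval M e s = nm x" "x = 0 \<longleftrightarrow> sat M e A" "eval M e t = nm y" "y = 0 \<longleftrightarrow> sat M e B"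
      using s t e unfolding represents_def by metis
    have "eval M e ?t = nm (x * y)" using e xy(1,3) by (simp add: eval_one)
    moreover have "x * y = 0 \<longleftrightarrow> sat M e (FDisj A B)" unfolding sat.simps xy(2,4)[symmetric] by auto
    ultimately show ?thesis by (intro exI[of _ "x * y"] conjI)
  qed
  ultimately show ?case unfolding represents_def by blast
next
  case (FImp A B)
  obtain s where s: "represents s A" using FImp.IH(1) FImp.prems by auto
  obtain t where t: "represents t B" using FImp.IH(2) FImp.prems by auto
  \<comment> \<open>\<open>1 - x\<close> vanishes exactly when \<open>x\<close> does not, so the
    product codes the disjunction of the negated premise with the conclusion.\<close>
  let ?t = "TApp (TApp (comp mulL) (TApp (TApp (comp monusL) one) s)) t"
  have "ty ?t = Some TZ" using s t by (simp add: represents_def one_def)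
  moreover have "\<exists>n. eval M e ?t = nm n \<and> (n = 0 \<longleftrightarrow> sat M e (FImp A B))" if e: "adm M e" for e
  proof -
    obtain x y where xy: "eval M e s = nm x" "x = 0 \<longleftrightarrow> sat M e A" "eval M e t = nm y" "y = 0 \<longleftrightarrow> sat M e B"
      using s t e unfolding represents_def by metis
    have "eval M e ?t = nm ((1 - x) * y)" using e xy(1,3) by (simp add: eval_one)
    moreover have "(1 - x) * y = 0 \<longleftrightarrow> sat M e (FImp A B)" unfolding sat.simps xy(2,4)[symmetric] by auto
    ultimately show ?thesis by (intro exI[of _ "(1 - x) * y"] conjI)
  qed
  ultimately show ?case unfolding represents_def by blast
qed simp_all

text \<open>Unbounded search finds the least zero of the characteristic term, which exists by
  hypothesis.\<close>

lemma qf_choice: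
  assumes A: "qf A" "wf_fm A" and e: "adm M e"
    and ex: "\<forall>f\<in>dom M T1. \<exists>x\<in>dom M TZ. sat M (upd (upd e a T1 f) b TZ x) A"
  shows "\<exists>Y\<in>dom M T2. \<forall>f\<in>dom M T1. sat M (upd (upd e a T1 f) b TZ (ap M Y f)) A"
proof -
  obtain t where t': "represents t A" using characteristic_term[OF A] by blast
  then have t: "ty t = Some TZ" by (simp add: represents_def)
  define h where "h = eval M e (absn a T1 (absn b TZ t))"
  \<comment> \<open>The constant function with value \<open>OMu\<close>: applying \<open>CS\<close>
    to \<open>m\<close> and \<open>h\<close> then sends \<open>f\<close> to the result of the search
    on \<open>h\<close> at \<open>f\<close>.\<close>
  define m where "m = ap M (cst M (CK T2 T1)) (code (Orc OMu))"
  define Y where "Y = ap M (ap M (cst M (CS T1 T1 TZ)) m) h"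
  have h: "h \<in> dom M (TFn T1 T1)" unfolding h_def using eval_dom[OF e] ty_absn t by blast
  have m: "m \<in> dom M (TFn T1 (TFn T1 TZ))" unfolding m_def using K_dom Orc_dom ap_dom by blast
  have "Y \<in> dom M T2" unfolding Y_def using S_dom m h ap_dom by blast
  moreover have "sat M (upd (upd e a T1 f) b TZ (ap M Y f)) A" if f: "f \<in> dom M T1" for f
  proof -
    let ?e = "upd e a T1 f"
    have e': "adm M ?e" using e f by (rule adm_upd)
    obtain u where u: "u \<in> supp p" "ap M h f = fn u" using ap_dom[OF h f] unfolding dom_T1 by blast
    have "nm (u n) = eval M (upd ?e b TZ (nm n)) t" for n
    proof -
      have "nm (u n) = ap M (ap M h f) (nm n)" using u by simp
      also have "ap M h f = eval M ?e (absn b TZ t)"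
        unfolding h_def using eval_absn[OF e f ty_absn[OF t]] .
      also have "ap M \<dots> (nm n) = eval M (upd ?e b TZ (nm n)) t" using eval_absn[OF e' nm_dom t] .
      finally show ?thesis .
    qed
    then have iff: "u n = 0 \<longleftrightarrow> sat M (upd ?e b TZ (nm n)) A" for n
      using t' adm_upd[OF e' nm_dom, of b n] nm_eq unfolding represents_def by metis
    have "\<exists>n. u n = 0" using ex f iff unfolding dom_TZ by blast
    then have "u (LEAST n. u n = 0) = 0" by (rule LeastI_ex)
    moreover have "ap M Y f = nm (LEAST n. u n = 0)"
      unfolding Y_def ap_S[OF m h f] u(2) unfolding m_def ap_K[OF Orc_dom f] ap_orc[OF u(1)] by simp
    ultimately show ?thesis using iff by simp
  qed
  ultimately show ?thesis by blast
qed

lemma rca0w_M: "rca0w M"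
  unfolding rca0w_def
proof (intro conjI)
  show "\<forall>x\<in>dom M TZ. ap M (cst M CSuc) x \<noteq> cst M CZero"
    by (simp add: dom_TZ cst_zero)
  show "\<forall>x\<in>dom M TZ. \<forall>y\<in>dom M TZ. ap M (cst M CSuc) x = ap M (cst M CSuc) y \<longrightarrow> x = y"
    by (auto simp: dom_TZ)
  show "\<forall>r s. \<forall>x\<in>dom M r. \<forall>y\<in>dom M s. exteq M r (ap M (ap M (cst M (CK r s)) x) y) x"
    using exteq_M by simp
  show "\<forall>r s t. \<forall>x\<in>dom M (TFn r (TFn s t)). \<forall>y\<in>dom M (TFn r s). \<forall>z\<in>dom M r.
      exteq M t (ap M (ap M (ap M (cst M (CS r s t)) x) y) z) (ap M (ap M x z) (ap M y z))"
    using exteq_M ap_dom by (metis ap_S)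
  show "\<forall>y\<in>dom M TZ. \<forall>z\<in>dom M (TFn TZ (TFn TZ TZ)).
        ap M (ap M (ap M (cst M CR) (cst M CZero)) y) z = y
      \<and> (\<forall>x\<in>dom M TZ. ap M (ap M (ap M (cst M CR) (ap M (cst M CSuc) x)) y) z
           = ap M (ap M z (ap M (ap M (ap M (cst M CR) x) y) z)) x)"
    using ap_rec by (auto simp: cst_zero dom_TZ)
  show "\<forall>r t. \<forall>z\<in>dom M (TFn r t). \<forall>x\<in>dom M r. \<forall>y\<in>dom M r.
        exteq M r x y \<longrightarrow> exteq M t (ap M z x) (ap M z y)"
    using exteq_M ap_dom by metis
  show "\<forall>A n e. qf A \<and> wf_fm A \<and> adm M e \<longrightarrow>
        sat M (upd e n TZ (cst M CZero)) A
        \<and> (\<forall>x\<in>dom M TZ. sat M (upd e n TZ x) A \<longrightarrow> sat M (upd e n TZ (ap M (cst M CSuc) x)) A)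
        \<longrightarrow> (\<forall>x\<in>dom M TZ. sat M (upd e n TZ x) A)"
  proof (intro allI impI)
    fix A n e
    assume a: "sat M (upd e n TZ (cst M CZero)) A
        \<and> (\<forall>x\<in>dom M TZ. sat M (upd e n TZ x) A \<longrightarrow> sat M (upd e n TZ (ap M (cst M CSuc) x)) A)"
    have "sat M (upd e n TZ (nm k)) A" for k
    proof (induction k)
      case 0
      then show ?case using a by (simp add: cst_zero)
    next
      case (Suc k)
      then have "sat M (upd e n TZ (ap M (cst M CSuc) (nm k))) A" using a nm_dom by blast
      then show ?case by simp
    qed
    then show "\<forall>x\<in>dom M TZ. sat M (upd e n TZ x) A" by (simp add: dom_TZ)
  qed
  show "\<forall>A a b e. qf A \<and> wf_fm A \<and> adm M e \<longrightarrow>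
        (\<forall>f\<in>dom M T1. \<exists>x\<in>dom M TZ. sat M (upd (upd e a T1 f) b TZ x) A)
        \<longrightarrow> (\<exists>Y\<in>dom M T2. \<forall>f\<in>dom M T1. sat M (upd (upd e a T1 f) b TZ (ap M Y f)) A)"
    using qf_choice by blast
qed

section \<open>The failure of \<open>PITo\<close>\<close>

lemma sat_inC:
  assumes "adm M e" "f \<in> supp p" "e j T1 = fn f"
  shows "sat M e (inC (TVar j T1)) \<longleftrightarrow> (\<forall>n. f n \<le> 1)"
proof -
  have "sat M (upd e 5 TZ (nm n)) (leF (TApp (TVar j T1) (TVar 5 TZ)) one) \<longleftrightarrow> f n \<le> 1" for n
    by (rule sat_leF[OF adm_upd[OF assms(1) nm_dom]]) (use assms eval_one in \<open>simp_all add: upd_apply\<close>)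
  then show ?thesis by (simp add: inC_def dom_TZ)
qed

text \<open>Strict inequality is coded as \<open>Suc n \<le> b\<close>, so the antecedent gives
  agreement at all \<open>n < b\<close>, which is the hypothesis of
  \<open>local_bound\<close>.\<close>

lemma sat_LOC_fm:
  assumes e: "adm M e" and F: "e 1 T2 = code (Orc OF)" and G: "e 2 T2 = code (Orc OG)"
  shows "sat M e LOC_fm"
proof -
  have "sat M e' (leF (TApp (TVar 1 T2) (TVar 2 T1)) (TApp (TVar 2 T2) (TVar 1 T1)))"
    if fg: "f \<in> supp p" "g \<in> supp p" and e': "e' = upd (upd e 1 T1 (fn f)) 2 T1 (fn g)"
      and loc: "sat M e' (FAll 1 TZ (FImp (ltF (TVar 1 TZ) (TApp (TVar 2 T2) (TVar 1 T1)))
          (FEq (TApp (TVar 2 T1) (TVar 1 TZ)) (TApp (TVar 1 T1) (TVar 1 TZ)))))" for f g e'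
  proof -
    obtain a b c d where fg': "p f = Some (a, b)" "p g = Some (c, d)" using fg by auto
    have adm: "adm M e'" unfolding e' using e fg by (simp add: adm_upd fn_dom)
    have lt: "sat M (upd e' 1 TZ (nm n)) (ltF (TVar 1 TZ) (TApp (TVar 2 T2) (TVar 1 T1))) \<longleftrightarrow> Suc n \<le> b" for n
      unfolding ltF_def
      by (rule sat_leF[OF adm_upd[OF adm nm_dom]]) (use fg fg' G in \<open>simp_all add: e' upd_apply ap_orc\<close>)
    have "g n = f n" if "n < b" for n
    proof -
      have "sat M (upd e' 1 TZ (nm n)) (FEq (TApp (TVar 2 T1) (TVar 1 TZ)) (TApp (TVar 1 T1) (TVar 1 TZ)))"
        using loc lt[of n] that nm_dom[of n] by (simp del: sat.simps(1))
      then show ?thesis using fg by (simp add: e' upd_apply)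
    qed
    then have "c \<le> b" using local_bound[OF fg'] by blast
    moreover have "sat M e' (leF (TApp (TVar 1 T2) (TVar 2 T1)) (TApp (TVar 2 T2) (TVar 1 T1))) \<longleftrightarrow> c \<le> b"
      by (rule sat_leF[OF adm]) (use fg fg' F G in \<open>simp_all add: e' upd_apply ap_orc\<close>)
    ultimately show ?thesis by blast
  qed
  then show ?thesis
    unfolding LOC_fm_def Let_def sat.simps(3,5,6) dom_T1 by blast
qed

lemma valid_not_PITo: "valid M (FNeg PITo)"
  unfolding valid_def
proof (intro allI impI)
  fix e assume e: "adm M e"
  have "\<not> sat M e PITo"
  proof
    assume "sat M e PITo"
    then have "\<exists>N\<in>dom M TZ. sat M (upd (upd (upd e 1 T2 (code (Orc OF))) 2 T2 (code (Orc OG))) 0 TZ N)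
        (FImp LOC_fm (FAll 2 T1 (FImp (inC (TVar 2 T1)) (leF (TApp (TVar 1 T2) (TVar 2 T1)) (TVar 0 TZ)))))"
      unfolding PITo_def Let_def sat.simps(6,7) using Orc_dom by blast
    then obtain N where
      N: "sat M (upd (upd (upd e 1 T2 (code (Orc OF))) 2 T2 (code (Orc OG))) 0 TZ (nm N))
        (FImp LOC_fm (FAll 2 T1 (FImp (inC (TVar 2 T1)) (leF (TApp (TVar 1 T2) (TVar 2 T1)) (TVar 0 TZ)))))"
      (is "sat M ?e _") unfolding dom_TZ by blast
    have e': "adm M ?e" using e by (simp add: adm_upd Orc_dom)
    have "sat M ?e LOC_fm" by (rule sat_LOC_fm[OF e']) (simp_all add: upd_apply)
    \<comment> \<open>The supposed bound \<open>N\<close> is refuted at a binary function where the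
      first functional takes the value \<open>Suc N\<close>.\<close>
    obtain g b where g: "\<forall>n. g n \<le> 1" "p g = Some (Suc N, b)" using unbounded by blast
    then have gp: "g \<in> supp p" by simp
    let ?e' = "upd ?e 2 T1 (fn g)"
    have e'': "adm M ?e'" using e' gp by (simp add: adm_upd fn_dom)
    have "sat M ?e' (inC (TVar 2 T1))" using sat_inC[OF e'' gp] g(1) by (simp add: upd_apply)
    then have "sat M ?e' (leF (TApp (TVar 1 T2) (TVar 2 T1)) (TVar 0 TZ))"
      using N \<open>sat M ?e LOC_fm\<close> fn_dom[OF gp] unfolding sat.simps(5,6) by blast
    moreover have "sat M ?e' (leF (TApp (TVar 1 T2) (TVar 2 T1)) (TVar 0 TZ)) \<longleftrightarrow> Suc N \<le> N"
      by (rule sat_leF[OF e'']) (use gp g(2) in \<open>simp_all add: upd_apply ap_orc\<close>)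
    ultimately show False by simp
  qed
  then show "sat M e (FNeg PITo)" by (simp add: FNeg_def)
qed

end

theorem theorem4p9:
  shows "\<exists>M :: nat str. model_Z2w M \<and> valid M (FNeg PITo)"
proof -
  obtain p where "generic p" using generic_exists by blast
  then interpret generic p .
  show ?thesis
    using is_str_M rca0w_M valid_Sk_ax valid_not_PITo unfolding model_Z2w_def by blast
qed

end
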